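(* Let $\{\nu_{nk}: n\ge 1,\ 1\le k\le k_n\}\subset\mathcal{M}_{\mathbb{T}}^{\times}$ be an infinitesimal triangular array of Borel probability measures on the unit circle $\mathbb{T}$ with nonzero first moments, let $\tau\in(0,\pi)$, and let $\nu_{nk}^\circ$ be the centered measures associated with $\tau$ (see context). Let $\{\lambda_n\}_{n=1}^\infty\subset\mathbb{T}$ be a sequence. The following assertions are equivalent: (1) The sequence $\nu_{n1}\boxtimes\nu_{n2}\boxtimes\cdots\boxtimes\nu_{nk_n}\boxtimes\delta_{\lambda_n}$ converges weakly to $m$ as $n\to\infty$, where $m$ is the Haar measure (normalized arclength measure) on $\mathbb{T}$. (2) $$\lim_{n\to\infty}\sum_{k=1}^{k_n}\int_{\mathbb{T}}(1-\Re t)\,d\nu_{nk}^{\circ}(t)=+\infty.$$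
   Context: $\mathbb{T}=\{z\in\mathbb{C}:|z|=1\}$. $\mathcal{M}_{\mathbb{T}}^{\times}$ is the set of Borel probability measures $\nu$ on $\mathbb{T}$ with $\int_{\mathbb{T}}t\,d\nu(t)\ne0$; $\delta_\lambda$ is the unit point mass at $\lambda$. $\arg$ denotes the principal value of the argument, and for $t\in\mathbb{T}$, $\log t=i\arg t$ is the principal branch. Free multiplicative convolution: for probability measures $\mu,\nu$ on $\mathbb{T}$, $\mu\boxtimes\nu$ is the distribution of $UV$, where $U,V$ are freely independent unitary random variables with distributions $\mu,\nu$. Analytically, for $\nu\in\mathcal{M}_{\mathbb{T}}^\times$ put $\psi_\nu(z)=\int_{\mathbb{T}}\frac{tz}{1-tz}\,d\nu(t)$ for $|z|<1$, let $\psi_\nu^{-1}$ be its inverse near $0$, $S_\nu(z)=\frac{1+z}{z}\psi_\nu^{-1}(z)$ and $\Sigma_\nu(z)=S_\nu\left(\frac{z}{1-z}\right)$ near $0$; then $\Sigma_{\mu\boxtimes\nu}=\Sigma_\mu\Sigma_\nu$ near $0$ for $\mu,\nu\in\mathcal{M}_{\mathbb{T}}^\times$. Infinitesimality: the array is infinitesimal if for every $\varepsilon>0$, $\lim_{n\to\infty}\max_{1\le k\le k_n}\nu_{nk}(\{t\in\mathbb{T}:|\arg t|\ge\varepsilon\})=0$. Centering: $b_{nk}=\exp\left(\int_{|\arg t|<\tau}\log t\,d\nu_{nk}(t)\right)\in\mathbb{T}$, and $\nu_{nk}^\circ$ is defined by $d\nu_{nk}^{\circ}(t)=d\nu_{nk}(b_{nk}t)$,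 i.e. $\nu_{nk}^\circ(A)=\nu_{nk}(b_{nk}A)$ for Borel $A\subset\mathbb{T}$. *)

theory Defs
  imports "HOL-Probability.Probability"
begin

section \<open>Probability measures on the unit circle\<close>

definition circle_borel :: "complex measure" where
  "circle_borel = restrict_space borel (sphere 0 1)"

definition circle_probs :: "complex measure set" where
  "circle_probs = {\<mu>. prob_space \<mu> \<and> space \<mu> = sphere 0 1 \<and> sets \<mu> = sets circle_borel}"

definition circle_probs_nz :: "complex measure set" where
  "circle_probs_nz = {\<mu> \<in> circle_probs. (\<integral>t. t \<partial>\<mu>) \<noteq> 0}"

definition circle_dirac :: "complex \<Rightarrow> complex measure" where
  "circle_dirac a = return circle_borel a"

definition circle_haar :: "complex measure" where
  "circle_haar = distr (uniform_measure lborel {-pi<..pi}) circle_borel cis"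

definition circle_weak_conv :: "(nat \<Rightarrow> complex measure) \<Rightarrow> complex measure \<Rightarrow> bool" where
  "circle_weak_conv \<rho> \<mu> \<longleftrightarrow>
     (\<forall>f :: complex \<Rightarrow> real. continuous_on (sphere 0 1) f \<longrightarrow>
        (\<lambda>n. \<integral>t. f t \<partial>(\<rho> n)) \<longlonglongrightarrow> (\<integral>t. f t \<partial>\<mu>))"

section \<open>Non-commutative probability spaces and freeness\<close>

text \<open>A unital complex *-algebra, carried by a whole type of class \<^class>\<open>ring_1\<close>, with a state.
  Neither a norm nor traciality is required, so tracial von Neumann algebras are included.\<close>

locale star_prob_space = vector_space scale
  for scale :: "complex \<Rightarrow> 'a::ring_1 \<Rightarrow> 'a" +
  fixes star :: "'a \<Rightarrow> 'a"
    and \<phi> :: "'a \<Rightarrow> complex"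
  assumes scale_mult_left: "scale c x * y = scale c (x * y)"
    and scale_mult_right: "x * scale c y = scale c (x * y)"
    and star_star: "star (star x) = x"
    and star_add: "star (x + y) = star x + star y"
    and star_scale: "star (scale c x) = scale (cnj c) (star x)"
    and star_mult: "star (x * y) = star y * star x"
    and state_add: "\<phi> (x + y) = \<phi> x + \<phi> y"
    and state_scale: "\<phi> (scale c x) = c * \<phi> x"
    and state_one: "\<phi> 1 = 1"
    and state_positive: "\<phi> (star x * x) \<in> \<real>\<^sub>\<ge>\<^sub>0"
begin

inductive_set star_alg_gen :: "'a set \<Rightarrow> 'a set" for S :: "'a set" where
  base: "x \<in> S \<Longrightarrow> x \<in> star_alg_gen S"
| one: "1 \<in> star_alg_gen S"
| add: "x \<in> star_alg_gen S \<Longrightarrow> y \<in> star_alg_gen S \<Longrightarrow> x + y \<in> star_alg_gen S"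
| mult: "x \<in> star_alg_gen S \<Longrightarrow> y \<in> star_alg_gen S \<Longrightarrow> x * y \<in> star_alg_gen S"
| scale: "x \<in> star_alg_gen S \<Longrightarrow> scale c x \<in> star_alg_gen S"
| star: "x \<in> star_alg_gen S \<Longrightarrow> star x \<in> star_alg_gen S"

text \<open>Freeness of a family of subalgebras: \<open>xs\<close> lists the factors of a product together with the
  index of the subalgebra each one is taken from; all factors are centred and neighbouring
  indices differ.\<close>

definition free_algebras :: "'i set \<Rightarrow> ('i \<Rightarrow> 'a set) \<Rightarrow> bool" where
  "free_algebras I B \<longleftrightarrow>
     (\<forall>xs :: ('i \<times> 'a) list. xs \<noteq> [] \<longrightarrow>
        (\<forall>(i, a) \<in> set xs. i \<in> I \<and> a \<in> B i \<and> \<phi> a = 0) \<longrightarrow>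
        distinct_adj (map fst xs) \<longrightarrow>
        \<phi> (prod_list (map snd xs)) = 0)"

definition freely_independent :: "'a \<Rightarrow> 'a \<Rightarrow> bool" where
  "freely_independent x y \<longleftrightarrow>
     free_algebras (UNIV :: bool set) (\<lambda>b. if b then star_alg_gen {x} else star_alg_gen {y})"

definition unitary_elem :: "'a \<Rightarrow> bool" where
  "unitary_elem u \<longleftrightarrow> star u * u = 1 \<and> u * star u = 1"

definition has_distribution :: "'a \<Rightarrow> complex measure \<Rightarrow> bool" where
  "has_distribution u \<mu> \<longleftrightarrow> \<mu> \<in> circle_probs \<and>
     (\<forall>j k :: nat. \<phi> (u ^ j * star u ^ k) = (\<integral>t. t ^ j * cnj t ^ k \<partial>\<mu>))"

end

section \<open>Free multiplicative convolution\<close>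

text \<open>\<open>\<rho>\<close> is the free multiplicative convolution of \<open>\<mu>\<close> and \<open>\<nu>\<close>: it is the distribution of
  \<open>U * V\<close> for free unitaries \<open>U\<close>, \<open>V\<close> with distributions \<open>\<mu>\<close>, \<open>\<nu>\<close>. Freeness determines the moments
  of \<open>U * V\<close>, so \<open>\<rho>\<close> depends neither on the realization nor on its type. That type is an
  explicit argument, because HOL cannot quantify over types inside a definition; a statement
  with \<open>TYPE('a)\<close> for a type variable \<open>'a\<close> covers realizations in all *-probability spaces.\<close>

definition is_free_mult_conv ::
  "'a::ring_1 itself \<Rightarrow> complex measure \<Rightarrow> complex measure \<Rightarrow> complex measure \<Rightarrow> bool" where
  "is_free_mult_conv T \<mu> \<nu> \<rho> \<longleftrightarrow>
     (\<exists>(scale :: complex \<Rightarrow> 'a \<Rightarrow> 'a) star \<phi> U V.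
        star_prob_space scale star \<phi> \<and>
        star_prob_space.unitary_elem star U \<and>
        star_prob_space.unitary_elem star V \<and>
        star_prob_space.freely_independent scale star \<phi> U V \<and>
        star_prob_space.has_distribution star \<phi> U \<mu> \<and>
        star_prob_space.has_distribution star \<phi> V \<nu> \<and>
        star_prob_space.has_distribution star \<phi> (U * V) \<rho>)"

text \<open>Iterated convolution of a nonempty list, bracketed to the left.\<close>

inductive is_free_mult_conv_list ::
  "'a::ring_1 itself \<Rightarrow> complex measure list \<Rightarrow> complex measure \<Rightarrow> bool"
  for T :: "'a itself" where
  single: "\<mu> \<in> circle_probs \<Longrightarrow> is_free_mult_conv_list T [\<mu>] \<mu>"
| snoc: "is_free_mult_conv_list T \<mu>s \<rho> \<Longrightarrow> is_free_mult_conv T \<rho> \<nu> \<sigma> \<Longrightarrow>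
         is_free_mult_conv_list T (\<mu>s @ [\<nu>]) \<sigma>"

section \<open>Infinitesimal arrays and centring\<close>

definition infinitesimal_array :: "(nat \<Rightarrow> nat) \<Rightarrow> (nat \<Rightarrow> nat \<Rightarrow> complex measure) \<Rightarrow> bool" where
  "infinitesimal_array k \<nu> \<longleftrightarrow>
     (\<forall>\<epsilon>>0. (\<lambda>n. MAX j\<in>{1..k n}. measure (\<nu> n j) {t \<in> sphere 0 1. \<bar>Arg t\<bar> \<ge> \<epsilon>}) \<longlonglongrightarrow> 0)"

definition centering_const :: "real \<Rightarrow> complex measure \<Rightarrow> complex" where
  "centering_const \<tau> \<nu> = exp (LINT t:{t \<in> sphere 0 1. \<bar>Arg t\<bar> < \<tau>}|\<nu>. Ln t)"

text \<open>The image of \<open>\<nu>\<close> under \<open>t \<mapsto> t / b\<close> gives a set \<open>A\<close> the mass \<open>\<nu> (b A)\<close>.\<close>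

definition centered :: "real \<Rightarrow> complex measure \<Rightarrow> complex measure" where
  "centered \<tau> \<nu> = distr \<nu> circle_borel (\<lambda>t. t / centering_const \<tau> \<nu>)"

end

theory Submission
  imports Defs "HOL-Real_Asymp.Real_Asymp"
begin

text \<open>
  Write \<open>u\<close> for the first moment of a measure \<open>\<nu>\<close> on the circle, and call \<open>1 - \<bar>u\<bar>\<^sup>2\<close>, the variance
  of \<open>\<nu>\<close>, its spread. Let \<open>S n\<close> be the sum of the spreads of \<open>\<nu> n 1, \<dots>, \<nu> n (k n)\<close>. Both
  assertions of the theorem turn out to be equivalent to the divergence of \<open>S\<close>.

  First moments are multiplicative under free convolution. The modulus of the first moment of \<open>\<rho> n\<close>
  is therefore a product of numbers \<open>\<surd>(1 - spread)\<close>, and lies between \<open>exp (- S n)\<close> and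
  \<open>exp (- S n / 2)\<close> once all spreads are at most \<open>1 / 2\<close>. The Haar measure has first moment \<open>0\<close>,
  so convergence to it forces \<open>S\<close> to diverge (\<open>exp_spread_le_first_moment\<close>).

  For the converse all moments of positive order have to tend to \<open>0\<close>. Multiply \<open>X\<close> by a free unitary
  \<open>V\<close> with mean \<open>u\<close>, and write \<open>V = u + 2 W\<close> with \<open>W\<close> centred. In the expansion of \<open>(X V)\<^sup>p\<close> the term
  without \<open>W\<close> contributes \<open>u\<^sup>p\<close> times the \<open>p\<close>-th moment of \<open>X\<close>. Freeness turns every other term into
  a combination of products of moments of \<open>X\<close> and moments of \<open>W\<close>. A moment of \<open>W\<close> of order one
  vanishes, and those of higher order are at most the spread of \<open>V\<close>. Two occurrences of \<open>W\<close>
  can only meet in one moment if the powers of \<open>X\<close> between them split off, so only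
  moments of \<open>X\<close> of order less than \<open>p\<close> occur (\<open>product_moment_bound\<close>). Hence the quotient of the
  \<open>p\<close>-th moment by the \<open>p\<close>-th power of the first moment changes in each step by at most a multiple of
  the spread, with a factor controlled by the quotients of lower order. By induction on \<open>p\<close> this
  quotient is bounded by a polynomial in \<open>S n\<close> (\<open>free_mult_conv_list_moment_bound\<close>), which the
  exponential decay of the first moment outweighs. Trigonometric polynomials are dense in
  the continuous functions, so the vanishing of the moments gives weak convergence
  (\<open>weak_conv_if_moments_tendsto\<close>).

  It remains to compare \<open>S\<close> with the sum in the second assertion. If \<open>1 - y + \<i> v\<close> is the first moment
  of the centred measure, then the spread is \<open>1 - (1 - y)\<^sup>2 - v\<^sup>2\<close>, which is at most \<open>2 y\<close>. The choice
  of the centring constant makes \<open>\<bar>v\<bar>\<close> at most a constant times \<open>y\<close> (\<open>centred_sine_bound\<close>), and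
  infinitesimality makes \<open>y\<close> uniformly small, so the spread is eventually at least \<open>y\<close>
  (\<open>centred_defect_le_spread\<close>).
\<close>

section \<open>Moments of words in two free elements\<close>

text \<open>In the application \<open>X\<close> is a multiple of a unitary, rescaled so that its moments of order below
  \<open>p\<close> have size at most \<open>K\<close>, and \<open>W\<close> is half of a centred unitary, for which \<open>x\<close> is a quarter of
  the variance. The moment of \<open>X\<close> of order \<open>p\<close> itself is left unbounded on purpose: the estimates
  below serve to show that it enters \<open>\<phi> ((X V)\<^sup>p)\<close> through the leading term only.\<close>
locale free_word_bounds = star_prob_space scale star \<phi>
  for scale :: "complex \<Rightarrow> 'a::ring_1 \<Rightarrow> 'a" and star \<phi> +
  fixes X W :: 'a and p :: nat and K x :: real
  assumes free: "freely_independent X W"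
    and K_ge_1: "1 \<le> K"
    and x_nonneg: "0 \<le> x"
    and x_le_1: "x \<le> 1"
    and X_bound: "q < p \<Longrightarrow> cmod (\<phi> (X ^ q)) \<le> K"
    and W_centred: "\<phi> W = 0"
    and W_bound: "0 < e \<Longrightarrow> cmod (\<phi> (W ^ e)) \<le> x"
begin

lemma phi_diff: "\<phi> (a - b) = \<phi> a - \<phi> b"
  using state_add[of "a - b" b] by (simp add: algebra_simps)

text \<open>Words are lists of powers of the two generators, with \<open>True\<close> for \<open>X\<close> and \<open>False\<close> for \<open>W\<close>.
  Neighbouring letters may belong to the same generator, because deleting a letter from an
  alternating word produces such neighbours.\<close>
definition letter :: "bool \<times> nat \<Rightarrow> 'a" where
  "letter l = (if fst l then X else W) ^ snd l"

definition word :: "(bool \<times> nat) list \<Rightarrow> 'a" where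
  "word xs = prod_list (map letter xs)"

definition centred_letter :: "bool \<times> nat \<Rightarrow> 'a" where
  "centred_letter l = letter l - scale (\<phi> (letter l)) 1"

definition centred_word :: "(bool \<times> nat) list \<Rightarrow> 'a" where
  "centred_word xs = prod_list (map centred_letter xs)"

definition X_degree :: "(bool \<times> nat) list \<Rightarrow> nat" where
  "X_degree xs = sum_list (map (\<lambda>l. if fst l then snd l else 0) xs)"

definition has_W :: "(bool \<times> nat) list \<Rightarrow> bool" where
  "has_W xs \<longleftrightarrow> (\<exists>l\<in>set xs. \<not> fst l)"

text \<open>The expected size of a word: each letter may be responsible for a moment of \<open>X\<close>, and a word
  that contains \<open>W\<close> gains one factor \<open>x\<close>, however many occurrences there are.\<close>
definition weight :: "(bool \<times> nat) list \<Rightarrow> real" where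
  "weight xs = (if has_W xs then x else 1) * K ^ length xs"

lemma word_simps [simp]:
  "word [] = 1" "word (l # xs) = letter l * word xs" "word (xs @ ys) = word xs * word ys"
  "centred_word [] = 1" "centred_word (l # xs) = centred_letter l * centred_word xs"
  by (simp_all add: word_def centred_word_def)

lemma X_degree_simps [simp]:
  "X_degree [] = 0" "X_degree (l # xs) = (if fst l then snd l else 0) + X_degree xs"
  "X_degree (xs @ ys) = X_degree xs + X_degree ys"
  by (simp_all add: X_degree_def)

lemma has_W_simps [simp]:
  "\<not> has_W []" "has_W (l # xs) \<longleftrightarrow> \<not> fst l \<or> has_W xs"
  "has_W (xs @ ys) \<longleftrightarrow> has_W xs \<or> has_W ys"
  by (auto simp: has_W_def)

lemma weight_nonneg: "0 \<le> weight xs"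
  using K_ge_1 x_nonneg by (simp add: weight_def)

lemma power_in_star_alg_gen: "a \<in> star_alg_gen S \<Longrightarrow> a ^ e \<in> star_alg_gen S"
  by (induction e) (auto intro: star_alg_gen.intros)

lemma centred_letter_in_alg:
  "centred_letter l \<in> (if fst l then star_alg_gen {X} else star_alg_gen {W})"
proof -
  let ?Y = "if fst l then X else W"
  have "letter l \<in> star_alg_gen {?Y}"
    unfolding letter_def by (intro power_in_star_alg_gen star_alg_gen.base) simp
  then have "letter l + scale (- \<phi> (letter l)) 1 \<in> star_alg_gen {?Y}"
    by (intro star_alg_gen.add star_alg_gen.scale star_alg_gen.one)
  then show ?thesis
    by (simp add: centred_letter_def scale_minus_left split: if_splits)
qed

lemma phi_centred_letter: "\<phi> (centred_letter l) = 0"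
  by (simp add: centred_letter_def phi_diff state_scale state_one)

text \<open>Freeness enters all estimates of this section through this lemma.\<close>
lemma phi_centred_word:
  assumes "xs \<noteq> []" "distinct_adj (map fst xs)"
  shows "\<phi> (centred_word xs) = 0"
proof -
  let ?ys = "map (\<lambda>l. (fst l, centred_letter l)) xs"
  have centred: "\<forall>(i, a)\<in>set ?ys. i \<in> UNIV \<and>
      a \<in> (if i then star_alg_gen {X} else star_alg_gen {W}) \<and> \<phi> a = 0"
    using centred_letter_in_alg by (simp add: phi_centred_letter split_beta)
  have nonempty: "?ys \<noteq> []" and alternating: "distinct_adj (map fst ?ys)"
    using assms by (simp_all add: o_def)
  have "\<phi> (prod_list (map snd ?ys)) = 0"
    by (rule free[unfolded freely_independent_def free_algebras_def,
          THEN spec, THEN mp, THEN mp, THEN mp, OF nonempty centred alternating])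
  then show ?thesis
    by (simp add: centred_word_def o_def)
qed

text \<open>The error made by centring the letters of \<open>ys\<close> after a fixed prefix. For an empty prefix and
  alternating \<open>ys\<close> it is the moment of the word itself, by \<open>phi_centred_word\<close>.\<close>
definition defect :: "(bool \<times> nat) list \<Rightarrow> (bool \<times> nat) list \<Rightarrow> complex" where
  "defect pre ys = \<phi> (word pre * word ys) - \<phi> (word pre * centred_word ys)"

lemma defect_Nil [simp]: "defect pre [] = 0"
  by (simp add: defect_def)

lemma defect_Cons:
  "defect pre (l # ys) =
     defect (pre @ [l]) ys + \<phi> (letter l) * \<phi> (word pre * centred_word ys)"
proof -
  have "word pre * (centred_letter l * centred_word ys) =
      word pre * letter l * centred_word ys -
      scale (\<phi> (letter l)) (word pre * centred_word ys)"
    by (simp add: centred_letter_def algebra_simps scale_mult_left scale_mult_right)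
  then show ?thesis
    by (simp add: defect_def phi_diff state_scale mult.assoc)
qed

text \<open>Centring one letter more replaces that letter by its moment, and what remains is a shorter word
  together with its own defect. This recursion takes the place of the expansion over all subsets
  of letters.\<close>
lemma defect_Cons':
  "defect pre (l # ys) =
     defect (pre @ [l]) ys + \<phi> (letter l) * (\<phi> (word (pre @ ys)) - defect pre ys)"
  by (simp add: defect_Cons) (simp add: defect_def)

lemma letter_bound:
  assumes "0 < snd l" "fst l \<Longrightarrow> snd l < p"
  shows "cmod (\<phi> (letter l)) \<le> weight [l]"
proof (cases "fst l")
  case True
  then show ?thesis using X_bound assms by (simp add: letter_def weight_def)
next
  case False
  then have "cmod (\<phi> (letter l)) \<le> x" using W_bound assms by (simp add: letter_def)
  also have "x \<le> x * K" using K_ge_1 x_nonneg by (simp add: mult_le_cancel_left1)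
  finally show ?thesis using False by (simp add: weight_def)
qed

lemma weight_remove: "weight [l] * weight (pre @ ys) \<le> weight (pre @ l # ys)"
proof -
  have "x * x \<le> x" using x_nonneg x_le_1 by (simp add: mult_left_le)
  then show ?thesis using K_ge_1 x_nonneg
    by (auto simp: weight_def power_add mult_left_mono mult_right_mono
        intro!: mult_right_mono)
qed

text \<open>Deleting a letter costs its moment; the weights are chosen such that this is never a loss, even
  if the deleted letter was the last \<open>W\<close>, since its moment then supplies the factor \<open>x\<close>.\<close>
lemma letter_removal:
  assumes "0 < snd l" "fst l \<Longrightarrow> snd l < p" "0 \<le> c" "cmod z \<le> c * weight (pre @ ys)"
  shows "cmod (\<phi> (letter l) * z) \<le> c * weight (pre @ l # ys)"
proof -
  have "cmod (\<phi> (letter l) * z) \<le> weight [l] * (c * weight (pre @ ys))"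
    using letter_bound[OF assms(1,2)] assms(4) weight_nonneg
    by (simp add: norm_mult mult_mono)
  also have "\<dots> = c * (weight [l] * weight (pre @ ys))" by simp
  also have "\<dots> \<le> c * weight (pre @ l # ys)"
    using weight_remove assms(3) by (rule mult_left_mono)
  finally show ?thesis .
qed

text \<open>The defect has one summand for each nonempty set of deleted letters, hence the factor
  \<open>2 ^ length ys - 1\<close>.\<close>
lemma defect_bound:
  assumes C: "0 \<le> C"
    and shorter: "\<And>zs. length zs < n \<Longrightarrow> X_degree zs < p \<Longrightarrow> \<forall>l\<in>set zs. 0 < snd l \<Longrightarrow>
        cmod (\<phi> (word zs)) \<le> C * weight zs"
  shows "length (pre @ ys) \<le> n \<Longrightarrow> X_degree (pre @ ys) < p \<Longrightarrow>
      \<forall>l\<in>set (pre @ ys). 0 < snd l \<Longrightarrow>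
      cmod (defect pre ys) \<le> (2 ^ length ys - 1) * C * weight (pre @ ys)"
proof (induction ys arbitrary: pre)
  case (Cons l ys)
  let ?m = "2 ^ length ys :: real"
  have 1: "cmod (defect (pre @ [l]) ys) \<le> (?m - 1) * C * weight (pre @ l # ys)"
    using Cons.IH[of "pre @ [l]"] Cons.prems by simp
  have "cmod (\<phi> (word (pre @ ys)) - defect pre ys) \<le>
      C * weight (pre @ ys) + (?m - 1) * C * weight (pre @ ys)"
    using Cons.prems by (intro order_trans[OF norm_triangle_ineq4] add_mono shorter Cons.IH) auto
  then have "cmod (\<phi> (word (pre @ ys)) - defect pre ys) \<le> ?m * C * weight (pre @ ys)"
    by (simp add: algebra_simps)
  then have 2: "cmod (\<phi> (letter l) * (\<phi> (word (pre @ ys)) - defect pre ys))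
      \<le> ?m * C * weight (pre @ l # ys)"
    using Cons.prems C by (intro letter_removal) auto
  show ?case
    unfolding defect_Cons'
    by (rule order_trans[OF norm_triangle_ineq], rule order_trans[OF add_mono[OF 1 2]])
       (simp add: algebra_simps)
qed simp

lemma not_alternating_split:
  "\<not> distinct_adj (map fst xs) \<Longrightarrow> \<exists>as b e f bs. xs = as @ (b, e) # (b, f) # bs"
  for xs :: "(bool \<times> nat) list"
proof (induction xs rule: induct_list012)
  case (3 l l' ls)
  show ?case
  proof (cases "fst l = fst l'")
    case True
    then have "l # l' # ls = [] @ (fst l, snd l) # (fst l, snd l') # ls"
      using True by (cases l; cases l') simp
    then show ?thesis by blast
  next
    case False
    then have "\<not> distinct_adj (map fst (l' # ls))"
      using 3 by simp
    then obtain as b e f bs where "l' # ls = as @ (b, e) # (b, f) # bs"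
      using 3 by blast
    then have "l # l' # ls = (l # as) @ (b, e) # (b, f) # bs" by simp
    then show ?thesis by blast
  qed
qed auto

lemma word_merge:
  "word (as @ (b, e) # (b, f) # bs) = word (as @ (b, e + f) # bs)"
  by (simp add: letter_def power_add mult.assoc)

text \<open>An alternating word equals its defect, which involves strictly shorter words only; in any other
  word two neighbouring letters can be merged. The restriction to degrees below \<open>p\<close> ensures that
  every moment of \<open>X\<close> that arises is bounded by \<open>K\<close>.\<close>
lemma word_bound:
  "X_degree xs < p \<Longrightarrow> \<forall>l\<in>set xs. 0 < snd l \<Longrightarrow>
    cmod (\<phi> (word xs)) \<le> 2 ^ (length xs)\<^sup>2 * weight xs"
proof (induction "length xs" arbitrary: xs rule: less_induct)
  case less
  consider "xs = []" | "xs \<noteq> []" "distinct_adj (map fst xs)" | "\<not> distinct_adj (map fst xs)"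
    by blast
  then show ?case
  proof cases
    case 1
    then show ?thesis by (simp add: state_one weight_def)
  next
    case 2
    define n where "n = length xs - 1"
    have n: "length xs = Suc n" using 2 by (simp add: n_def)
    let ?C = "2 ^ n\<^sup>2 :: real"
    have "cmod (\<phi> (word zs)) \<le> ?C * weight zs"
      if "length zs < length xs" "X_degree zs < p" "\<forall>l\<in>set zs. 0 < snd l" for zs
    proof -
      have "cmod (\<phi> (word zs)) \<le> 2 ^ (length zs)\<^sup>2 * weight zs"
        using less(1) that by blast
      also have "\<dots> \<le> ?C * weight zs"
        using that(1) n
        by (intro mult_right_mono power_increasing power_mono weight_nonneg) simp_all
      finally show ?thesis .
    qed
    then have "cmod (defect [] xs) \<le> (2 ^ length xs - 1) * ?C * weight ([] @ xs)"
      using less.prems by (intro defect_bound[where n = "length xs"]) auto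
    moreover have "defect [] xs = \<phi> (word xs)"
      using phi_centred_word[of xs] 2 by (simp add: defect_def)
    moreover have "(2 ^ length xs - 1) * ?C \<le> 2 ^ (length xs)\<^sup>2"
    proof -
      have "(2 ^ length xs - 1) * ?C \<le> 2 ^ length xs * ?C"
        by (intro mult_right_mono) auto
      also have "\<dots> = 2 ^ (Suc n + n\<^sup>2)" by (simp add: n power_add)
      also have "\<dots> \<le> 2 ^ (Suc n)\<^sup>2"
        by (intro power_increasing) (simp_all add: power2_eq_square)
      finally show ?thesis by (simp only: n)
    qed
    ultimately show ?thesis
      using mult_right_mono[OF _ weight_nonneg[of xs]] by fastforce
  next
    case 3
    then obtain as b e f bs where xs: "xs = as @ (b, e) # (b, f) # bs"
      using not_alternating_split by blast
    let ?zs = "as @ (b, e + f) # bs"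
    have "cmod (\<phi> (word ?zs)) \<le> 2 ^ (length ?zs)\<^sup>2 * weight ?zs"
      using less.prems by (intro less.hyps) (auto simp: xs split: if_splits)
    also have "\<dots> \<le> 2 ^ (length xs)\<^sup>2 * weight xs"
    proof (intro mult_mono power_increasing power_mono)
      have "has_W ?zs = has_W xs" by (auto simp: xs)
      moreover have "K ^ length ?zs \<le> K ^ length xs"
        using K_ge_1 by (intro power_increasing) (auto simp: xs)
      ultimately show "weight ?zs \<le> weight xs"
        using x_nonneg by (simp add: weight_def mult_left_mono)
    qed (auto simp: xs weight_nonneg)
    finally show ?thesis using xs word_merge by simp
  qed
qed

text \<open>In degree \<open>p\<close> merging could produce the uncontrolled power \<open>X\<^sup>p\<close>. This is excluded here because
  a letter \<open>W\<close> of exponent one has moment \<open>0\<close>, so that only powers of \<open>X\<close> are effectively deleted,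
  and the deletion of the first of them leads back to degree below \<open>p\<close>.\<close>
lemma top_defect_bound:
  assumes C: "\<And>m. m \<le> n \<Longrightarrow> 2 ^ m\<^sup>2 \<le> C"
  shows "length (pre @ ys) \<le> n \<Longrightarrow> X_degree (pre @ ys) \<le> p \<Longrightarrow> has_W (pre @ ys) \<Longrightarrow>
      \<forall>l\<in>set pre. 0 < snd l \<Longrightarrow>
      \<forall>l\<in>set ys. 0 < snd l \<and> (fst l \<longrightarrow> snd l < p) \<and> (fst l \<or> snd l = 1) \<Longrightarrow>
      cmod (defect pre ys) \<le> (2 ^ length ys - 1) * C * weight (pre @ ys)"
proof (induction ys arbitrary: pre)
  case (Cons l ys)
  let ?m = "2 ^ length ys :: real"
  have C0: "0 \<le> C" using C[of 0] by simp
  have pos: "\<forall>l\<in>set (pre @ l # ys). 0 < snd l"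
    using Cons.prems(4,5) by auto
  have 1: "cmod (defect (pre @ [l]) ys) \<le> (?m - 1) * C * weight (pre @ l # ys)"
    using Cons.IH[of "pre @ [l]"] Cons.prems pos by simp
  have 2: "cmod (\<phi> (letter l) * (\<phi> (word (pre @ ys)) - defect pre ys))
      \<le> ?m * C * weight (pre @ l # ys)"
  proof (cases "fst l")
    case True
    have short: "cmod (\<phi> (word zs)) \<le> C * weight zs"
      if "length zs < n" "X_degree zs < p" "\<forall>l\<in>set zs. 0 < snd l" for zs
      using word_bound[OF that(2,3)] C[of "length zs"] that(1) weight_nonneg[of zs]
      by (meson less_imp_le mult_right_mono order_trans)
    have deg: "X_degree (pre @ ys) < p" using Cons.prems True by auto
    have "cmod (\<phi> (word (pre @ ys)) - defect pre ys) \<le>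
        C * weight (pre @ ys) + (?m - 1) * C * weight (pre @ ys)"
      using Cons.prems pos deg C0
      by (intro order_trans[OF norm_triangle_ineq4] add_mono short defect_bound[where n = n]) auto
    then have "cmod (\<phi> (word (pre @ ys)) - defect pre ys) \<le> ?m * C * weight (pre @ ys)"
      by (simp add: algebra_simps)
    then show ?thesis
      using Cons.prems C0 by (intro letter_removal) auto
  next
    case False
    then have "\<phi> (letter l) = 0" using Cons.prems W_centred by (simp add: letter_def)
    then show ?thesis using C0 weight_nonneg by simp
  qed
  show ?case
    unfolding defect_Cons'
    by (rule order_trans[OF norm_triangle_ineq], rule order_trans[OF add_mono[OF 1 2]])
       (simp add: algebra_simps)
qed simp

text \<open>The words that occur in the expansion of \<open>(X (u + 2 W))\<^sup>p\<close>, apart from the one without \<open>W\<close>,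
  and all words obtained from them by merging neighbouring powers of \<open>X\<close>.\<close>
definition top_word :: "(bool \<times> nat) list \<Rightarrow> bool" where
  "top_word xs \<longleftrightarrow> xs \<noteq> [] \<and> fst (hd xs) \<and> has_W xs \<and> X_degree xs = p \<and>
     (\<forall>l\<in>set xs. 0 < snd l \<and> (fst l \<or> snd l = 1)) \<and>
     successively (\<lambda>l l'. fst l \<or> fst l') xs"

text \<open>After merging, the word alternates. Its first letter is a power of \<open>X\<close>; deleting that letter
  contributes nothing, since the rest is still alternating, so its possibly large moment
  does not matter. All later powers of \<open>X\<close> have exponent below \<open>p\<close>.\<close>
lemma top_word_bound:
  "top_word xs \<Longrightarrow> cmod (\<phi> (word xs)) \<le> 4 ^ (length xs)\<^sup>2 * (x * K ^ length xs)"
proof (induction "length xs" arbitrary: xs rule: less_induct)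
  case less
  then have W: "has_W xs" and len: "length xs > 0" by (auto simp: top_word_def)
  show ?case
  proof (cases "distinct_adj (map fst xs)")
    case True
    obtain l ys where xs: "xs = l # ys" using less.prems by (cases xs) (auto simp: top_word_def)
    have l: "fst l" "0 < snd l" and ys: "ys \<noteq> []" using less.prems by (auto simp: top_word_def xs)
    have lt: "snd l' < p" if "l' \<in> set ys" "fst l'" for l'
    proof -
      have "snd l' \<in> set (map (\<lambda>l. if fst l then snd l else 0) ys)"
        using that by force
      then have "snd l' \<le> X_degree ys"
        unfolding X_degree_def by (rule member_le_sum_list) simp_all
      then show ?thesis using l less.prems by (simp add: top_word_def xs)
    qed
    have alt: "distinct_adj (map fst ys)" using True by (auto simp: xs distinct_adj_Cons)
    have "\<phi> (word xs) = defect [] xs"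
      using phi_centred_word[OF _ True] len by (simp add: defect_def)
    also have "\<dots> = defect [l] ys"
      unfolding xs defect_Cons using phi_centred_word[OF ys alt] by simp
    finally have "cmod (\<phi> (word xs)) = cmod (defect [l] ys)" by simp
    also have "\<dots> \<le> (2 ^ length ys - 1) * 2 ^ (length xs)\<^sup>2 * weight ([l] @ ys)"
      using less.prems l lt
      by (intro top_defect_bound[where n = "length xs"])
         (auto simp: top_word_def xs intro!: power_increasing power_mono)
    also have "\<dots> \<le> 2 ^ (length xs)\<^sup>2 * 2 ^ (length xs)\<^sup>2 * weight ([l] @ ys)"
    proof (intro mult_right_mono)
      have "(2::real) ^ length ys \<le> 2 ^ (length xs)\<^sup>2"
        by (intro power_increasing) (auto simp: xs power2_eq_square)
      then show "(2::real) ^ length ys - 1 \<le> 2 ^ (length xs)\<^sup>2" by linarith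
    qed (auto simp: weight_nonneg)
    also have "weight ([l] @ ys) = x * K ^ length xs" using W by (simp add: weight_def xs)
    also have "(2::real) ^ (length xs)\<^sup>2 * 2 ^ (length xs)\<^sup>2 = 4 ^ (length xs)\<^sup>2"
      by (simp flip: power_mult_distrib)
    finally show ?thesis .
  next
    case False
    then obtain as b e f bs where xs: "xs = as @ (b, e) # (b, f) # bs"
      using not_alternating_split by blast
    let ?zs = "as @ (b, e + f) # bs"
    have b: b using less.prems by (auto simp: top_word_def xs successively_append_iff)
    have "top_word ?zs"
      using less.prems b
      by (auto simp: top_word_def xs successively_append_iff successively_Cons hd_append
          split: if_splits)
    then have "cmod (\<phi> (word ?zs)) \<le> 4 ^ (length ?zs)\<^sup>2 * (x * K ^ length ?zs)"
      by (intro less.hyps) (auto simp: xs)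
    also have "\<dots> \<le> 4 ^ (length xs)\<^sup>2 * (x * K ^ length xs)"
      using K_ge_1 x_nonneg
      by (intro mult_mono power_increasing power_mono) (auto simp: xs)
    finally show ?thesis using xs word_merge by simp
  qed
qed

text \<open>The factors \<open>X (u + 2 W)\<close> are expanded one at a time from the left, the prefix recording the
  choices made so far. Each choice of \<open>2 W\<close> doubles the term, which gives the constant \<open>(1 + 2) ^ j\<close>
  minus the contribution of the choice of \<open>u\<close> throughout.\<close>
lemma power_expansion_bound:
  fixes u :: complex
  defines "U \<equiv> scale u 1 + scale 2 W"
  assumes u: "cmod u \<le> 1"
    and B: "\<And>xs. top_word xs \<Longrightarrow> length xs \<le> 2 * p \<Longrightarrow> cmod (\<phi> (word xs)) \<le> B"
  shows "\<forall>l\<in>set pre. snd l = 1 \<Longrightarrow> pre \<noteq> [] \<longrightarrow> fst (hd pre) \<Longrightarrow>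
      successively (\<lambda>l l'. fst l \<or> fst l') pre \<Longrightarrow> X_degree pre + j = p \<Longrightarrow>
      length pre + 2 * j \<le> 2 * p \<Longrightarrow>
      cmod (\<phi> (word pre * (X * U) ^ j) - u ^ j * \<phi> (word pre * X ^ j)) \<le> (3 ^ j - 1) * B"
proof (induction j arbitrary: pre)
  case (Suc j)
  let ?pX = "pre @ [(True, 1)]" and ?pXW = "pre @ [(True, 1), (False, 1)]"
  have XU: "X * U = scale u X + scale 2 (X * W)"
    by (simp add: U_def distrib_left scale_mult_right)
  have eq: "\<phi> (word pre * (X * U) ^ Suc j) =
      u * \<phi> (word ?pX * (X * U) ^ j) + 2 * \<phi> (word ?pXW * (X * U) ^ j)"
    by (simp only: power_Suc XU)
       (simp add: letter_def distrib_right distrib_left scale_mult_left scale_mult_right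
        state_add state_scale mult.assoc)
  have 1: "cmod (\<phi> (word ?pX * (X * U) ^ j) - u ^ j * \<phi> (word ?pX * X ^ j)) \<le> (3 ^ j - 1) * B"
    using Suc.prems by (intro Suc.IH) (auto simp: successively_append_iff hd_append)
  have 2: "cmod (\<phi> (word ?pXW * (X * U) ^ j) - u ^ j * \<phi> (word ?pXW * X ^ j)) \<le> (3 ^ j - 1) * B"
    using Suc.prems by (intro Suc.IH) (auto simp: successively_append_iff hd_append)
  let ?rest = "replicate j (True, Suc 0)"
  have rest: "word ?rest = X ^ j" "X_degree ?rest = j" "successively (\<lambda>l l'. fst l \<or> fst l') ?rest"
    by (induction j) (auto simp: letter_def successively_Cons)
  have "top_word (?pXW @ ?rest)"
    using Suc.prems rest
    by (cases "j = 0") (auto simp: top_word_def successively_append_iff successively_Cons hd_append)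
  then have "cmod (\<phi> (word (?pXW @ ?rest))) \<le> B"
    using Suc.prems by (intro B) auto
  then have 3: "cmod (\<phi> (word ?pXW * X ^ j)) \<le> B"
    by (simp add: rest mult.assoc)
  have B0: "0 \<le> B" using 3 norm_ge_zero order_trans by blast
  have uj: "cmod (u ^ j) \<le> 1" using u by (simp add: norm_power power_le_one)
  have Xj: "\<phi> (word pre * X ^ Suc j) = \<phi> (word ?pX * X ^ j)"
    by (simp add: letter_def mult.assoc)
  define D1 where "D1 = \<phi> (word ?pX * (X * U) ^ j) - u ^ j * \<phi> (word ?pX * X ^ j)"
  define D2 where "D2 = \<phi> (word ?pXW * (X * U) ^ j) - u ^ j * \<phi> (word ?pXW * X ^ j)"
  have "\<phi> (word pre * (X * U) ^ Suc j) - u ^ Suc j * \<phi> (word pre * X ^ Suc j)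
      = u * D1 + (2 * D2 + 2 * (u ^ j * \<phi> (word ?pXW * X ^ j)))"
    unfolding eq Xj D1_def D2_def by (simp add: algebra_simps)
  also have "cmod \<dots> \<le> (3 ^ j - 1) * B + (2 * ((3 ^ j - 1) * B) + 2 * B)"
  proof (intro order_trans[OF norm_triangle_ineq] add_mono)
    show "cmod (u * D1) \<le> (3 ^ j - 1) * B"
      using u 1 by (metis D1_def mult_left_le_one_le norm_ge_zero norm_mult order_trans)
    show "cmod (2 * D2) \<le> 2 * ((3 ^ j - 1) * B)"
      using 2[folded D2_def] by (simp add: norm_mult)
    show "cmod (2 * (u ^ j * \<phi> (word ?pXW * X ^ j))) \<le> 2 * B"
      using mult_mono[OF uj 3] by (simp add: norm_mult)
  qed
  also have "\<dots> = (3 ^ Suc j - 1) * B" by (simp add: algebra_simps)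
  finally show ?case .
qed simp

lemma product_first_moment: "\<phi> (X * (scale u 1 + scale 2 W)) = u * \<phi> X"
proof -
  have "\<phi> (centred_word [(True, 1), (False, 1)]) = 0"
    by (rule phi_centred_word) simp_all
  then have "\<phi> (X * W) = 0"
    by (simp add: centred_letter_def letter_def W_centred left_diff_distrib phi_diff
        scale_mult_left state_scale)
  then show ?thesis
    by (simp add: distrib_left scale_mult_right state_add state_scale)
qed

lemma product_moment_bound:
  assumes "cmod u \<le> 1"
  shows "cmod (\<phi> ((X * (scale u 1 + scale 2 W)) ^ p) - u ^ p * \<phi> (X ^ p))
     \<le> 3 ^ p * 4 ^ (2 * p)\<^sup>2 * K ^ (2 * p) * x"
proof -
  let ?B = "4 ^ (2 * p)\<^sup>2 * (x * K ^ (2 * p))"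
  have B: "cmod (\<phi> (word xs)) \<le> ?B" if "top_word xs" "length xs \<le> 2 * p" for xs
    using that K_ge_1 x_nonneg
    by (intro order_trans[OF top_word_bound] mult_mono power_increasing power_mono) auto
  have "cmod (\<phi> (word [] * (X * (scale u 1 + scale 2 W)) ^ p) - u ^ p * \<phi> (word [] * X ^ p))
      \<le> (3 ^ p - 1) * ?B"
    using assms B by (intro power_expansion_bound) auto
  also have "\<dots> \<le> 3 ^ p * ?B" using x_nonneg K_ge_1 by (intro mult_right_mono) auto
  finally show ?thesis by (simp add: algebra_simps)
qed

end

section \<open>Measures on the circle and their spread\<close>

lemma circle_prob_space: "\<mu> \<in> circle_probs \<Longrightarrow> prob_space \<mu>"
  by (simp add: circle_probs_def)

lemma circle_space: "\<mu> \<in> circle_probs \<Longrightarrow> space \<mu> = sphere 0 1"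
  by (simp add: circle_probs_def)

lemma borel_measurable_circle_subspace:
  assumes "\<mu> \<in> circle_probs" "f \<in> borel_measurable (restrict_space borel (sphere 0 1))"
  shows "f \<in> borel_measurable \<mu>"
  using assms
  by (subst measurable_cong_sets[of \<mu> circle_borel borel borel])
     (simp_all add: circle_probs_def circle_borel_def)

lemma borel_measurable_circle:
  "\<mu> \<in> circle_probs \<Longrightarrow> f \<in> borel_measurable borel \<Longrightarrow> f \<in> borel_measurable \<mu>"
  by (auto intro: borel_measurable_circle_subspace measurable_restrict_space1)

lemma integrable_circle_continuous:
  fixes f :: "complex \<Rightarrow> 'b::{banach, second_countable_topology}"
  assumes \<mu>: "\<mu> \<in> circle_probs" and f: "continuous_on (sphere 0 1) f"
  shows "integrable \<mu> f"
proof -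
  interpret prob_space \<mu> using circle_prob_space[OF \<mu>] .
  have "bounded (f ` sphere 0 1)"
    using f by (intro compact_imp_bounded compact_continuous_image) auto
  then obtain b where b: "\<forall>t\<in>sphere 0 1. norm (f t) \<le> b"
    by (auto simp: bounded_iff)
  have "f \<in> borel_measurable \<mu>"
    by (intro borel_measurable_circle_subspace[OF \<mu>] borel_measurable_continuous_on_restrict f)
  then show ?thesis
    using b by (intro integrable_const_bound[of _ b]) (auto simp: circle_space[OF \<mu>])
qed

lemma norm_circle_integral_le:
  fixes f :: "complex \<Rightarrow> 'b::{banach, second_countable_topology}"
  assumes \<mu>: "\<mu> \<in> circle_probs" and f: "integrable \<mu> f" and g: "integrable \<mu> g"
    and le: "\<And>t. cmod t = 1 \<Longrightarrow> norm (f t) \<le> g t"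
  shows "norm (\<integral>t. f t \<partial>\<mu>) \<le> (\<integral>t. g t \<partial>\<mu>)"
proof -
  have "norm (\<integral>t. f t \<partial>\<mu>) \<le> (\<integral>t. norm (f t) \<partial>\<mu>)"
    by (rule integral_norm_bound)
  also have "\<dots> \<le> (\<integral>t. g t \<partial>\<mu>)"
    using assms by (intro integral_mono integrable_norm) (auto simp: circle_space)
  finally show ?thesis .
qed

definition circle_moment :: "complex measure \<Rightarrow> nat \<Rightarrow> complex" where
  "circle_moment \<mu> q = (\<integral>t. t ^ q \<partial>\<mu>)"

text \<open>The variance of a measure on the circle, see \<open>spread_eq_variance\<close>.\<close>
definition spread :: "complex measure \<Rightarrow> real" where
  "spread \<mu> = 1 - (cmod (circle_moment \<mu> 1))\<^sup>2"

lemma circle_moment_0: "\<mu> \<in> circle_probs \<Longrightarrow> circle_moment \<mu> 0 = 1"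
  using prob_space.prob_space[OF circle_prob_space] by (simp add: circle_moment_def)

lemma cmod_circle_moment_le: "\<mu> \<in> circle_probs \<Longrightarrow> cmod (circle_moment \<mu> q) \<le> 1"
  unfolding circle_moment_def
  using norm_circle_integral_le[of \<mu> "\<lambda>t. t ^ q" "\<lambda>_. 1"]
    prob_space.prob_space[OF circle_prob_space, of \<mu>]
  by (simp add: norm_power integrable_circle_continuous continuous_intros)

lemma spread_nonneg: "\<mu> \<in> circle_probs \<Longrightarrow> 0 \<le> spread \<mu>"
  using cmod_circle_moment_le[of \<mu> 1] by (simp add: spread_def power_le_one)

lemma spread_eq_variance:
  assumes \<mu>: "\<mu> \<in> circle_probs"
  defines "u \<equiv> circle_moment \<mu> 1"
  shows "(\<integral>t. (cmod (t - u))\<^sup>2 \<partial>\<mu>) = spread \<mu>"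
proof -
  interpret prob_space \<mu> using circle_prob_space[OF \<mu>] .
  have I: "integrable \<mu> (\<lambda>t. cnj u * t)"
    by (intro integrable_circle_continuous \<mu> continuous_intros)
  have "(\<integral>t. (cmod (t - u))\<^sup>2 \<partial>\<mu>) = (\<integral>t. (1 + (cmod u)\<^sup>2) - 2 * Re (cnj u * t) \<partial>\<mu>)"
  proof (intro Bochner_Integration.integral_cong refl)
    fix t assume "t \<in> space \<mu>"
    then have "(cmod t)\<^sup>2 = 1" by (simp add: circle_space[OF \<mu>])
    then show "(cmod (t - u))\<^sup>2 = (1 + (cmod u)\<^sup>2) - 2 * Re (cnj u * t)"
      by (simp add: cmod_power2) (simp add: power2_eq_square algebra_simps)
  qed
  also have "\<dots> = (1 + (cmod u)\<^sup>2) - 2 * (\<integral>t. Re (cnj u * t) \<partial>\<mu>)"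
    using integrable_Re[OF I] prob_space
    by (subst Bochner_Integration.integral_diff) (auto simp del: times_complex.simps)
  also have "(\<integral>t. Re (cnj u * t) \<partial>\<mu>) = Re (cnj u * u)"
    using integral_Re[OF I] by (simp add: u_def circle_moment_def del: times_complex.simps)
  also have "Re (cnj u * u) = (cmod u)\<^sup>2"
    by (simp add: cmod_power2) (simp add: power2_eq_square)
  finally show ?thesis by (simp add: spread_def u_def)
qed

text \<open>Since \<open>(t - u) / 2\<close> has modulus at most one, its powers are dominated by its square; the factor
  \<open>1 / 2\<close> in the definition of \<open>W\<close> has this purpose.\<close>
lemma centred_moment_bound:
  assumes \<mu>: "\<mu> \<in> circle_probs" and e: "0 < e"
  defines "u \<equiv> circle_moment \<mu> 1"
  shows "cmod (\<integral>t. ((t - u) / 2) ^ e \<partial>\<mu>) \<le> spread \<mu> / 4"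
proof (cases "e = 1")
  case True
  interpret prob_space \<mu> using circle_prob_space[OF \<mu>] .
  have "integrable \<mu> (\<lambda>t. t)"
    by (intro integrable_circle_continuous \<mu> continuous_intros)
  then show ?thesis
    using True spread_nonneg[OF \<mu>] prob_space by (simp add: u_def circle_moment_def)
next
  case False
  have u: "cmod u \<le> 1" using cmod_circle_moment_le[OF \<mu>] by (simp add: u_def)
  have "cmod (\<integral>t. ((t - u) / 2) ^ e \<partial>\<mu>) \<le> (\<integral>t. (cmod (t - u))\<^sup>2 / 4 \<partial>\<mu>)"
  proof (intro norm_circle_integral_le \<mu> integrable_circle_continuous continuous_intros)
    fix t :: complex assume t: "cmod t = 1"
    have "cmod ((t - u) / 2) \<le> 1" using norm_triangle_ineq4[of t u] t u by (simp add: norm_divide)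
    then have "cmod ((t - u) / 2) ^ e \<le> cmod ((t - u) / 2) ^ 2"
      using False e by (intro power_decreasing) auto
    then show "cmod (((t - u) / 2) ^ e) \<le> (cmod (t - u))\<^sup>2 / 4"
      by (simp add: norm_power norm_divide power_divide)
  qed auto
  then show ?thesis using spread_eq_variance[OF \<mu>] by (simp add: u_def)
qed

section \<open>Moments of free multiplicative convolutions\<close>

context star_prob_space
begin

lemma star_alg_gen_least: "y \<in> star_alg_gen S \<Longrightarrow> star_alg_gen {y} \<subseteq> star_alg_gen S"
proof
  fix z assume y: "y \<in> star_alg_gen S" and "z \<in> star_alg_gen {y}"
  from this(2) show "z \<in> star_alg_gen S"
    by induction (use y in \<open>auto intro: star_alg_gen.intros\<close>)
qed

lemma freely_independent_subalgebra:
  assumes "freely_independent U V" "X \<in> star_alg_gen {U}" "W \<in> star_alg_gen {V}"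
  shows "freely_independent X W"
  unfolding freely_independent_def free_algebras_def
proof (intro allI impI)
  fix xs :: "(bool \<times> 'a) list"
  assume ne: "xs \<noteq> []"
    and mem: "\<forall>(i, a)\<in>set xs. i \<in> UNIV \<and>
      a \<in> (if i then star_alg_gen {X} else star_alg_gen {W}) \<and> \<phi> a = 0"
    and dist: "distinct_adj (map fst xs)"
  have mem': "\<forall>(i, a)\<in>set xs. i \<in> UNIV \<and>
      a \<in> (if i then star_alg_gen {U} else star_alg_gen {V}) \<and> \<phi> a = 0"
    using mem star_alg_gen_least[OF assms(2)] star_alg_gen_least[OF assms(3)]
    by (fastforce split: if_splits)
  show "\<phi> (prod_list (map snd xs)) = 0"
    by (rule assms(1)[unfolded freely_independent_def free_algebras_def,
          THEN spec, THEN mp, THEN mp, THEN mp, OF ne mem' dist])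
qed

lemma scale_power: "(scale c y) ^ n = scale (c ^ n) (y ^ n)"
  by (induction n) (simp_all add: scale_mult_left scale_mult_right mult.commute)

lemma moment_has_distribution:
  "has_distribution u \<mu> \<Longrightarrow> \<phi> (u ^ j) = circle_moment \<mu> j"
  unfolding has_distribution_def circle_moment_def
  by (elim conjE allE[of _ j] allE[of _ 0]) simp

lemma shifted_moment_has_distribution:
  assumes "has_distribution V \<nu>"
  shows "\<phi> (V ^ i * (V - scale u 1) ^ e) = (\<integral>t. t ^ i * (t - u) ^ e \<partial>\<nu>)"
proof (induction e arbitrary: i)
  case 0
  then show ?case using moment_has_distribution[OF assms] by (simp add: circle_moment_def)
next
  case (Suc e)
  have \<nu>: "\<nu> \<in> circle_probs" using assms by (simp add: has_distribution_def)
  have "V ^ i * (V - scale u 1) ^ Suc e =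
      V ^ Suc i * (V - scale u 1) ^ e - scale u (V ^ i * (V - scale u 1) ^ e)"
    by (simp add: left_diff_distrib right_diff_distrib scale_mult_left scale_mult_right
        power_Suc2[of V] mult.assoc del: power_Suc) (simp add: left_diff_distrib scale_mult_left
        right_diff_distrib scale_mult_right mult.assoc)
  then have "\<phi> (V ^ i * (V - scale u 1) ^ Suc e) =
      \<phi> (V ^ Suc i * (V - scale u 1) ^ e) - u * \<phi> (V ^ i * (V - scale u 1) ^ e)"
    using state_add[of "V ^ Suc i * (V - scale u 1) ^ e - scale u (V ^ i * (V - scale u 1) ^ e)"
        "scale u (V ^ i * (V - scale u 1) ^ e)"]
    by (simp add: state_scale)
  also have "\<dots> = (\<integral>t. t ^ Suc i * (t - u) ^ e - u * (t ^ i * (t - u) ^ e) \<partial>\<nu>)"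
    unfolding Suc.IH
    by (subst Bochner_Integration.integral_diff)
       (auto intro!: integrable_circle_continuous \<nu> continuous_intros)
  also have "\<dots> = (\<integral>t. t ^ i * (t - u) ^ Suc e \<partial>\<nu>)"
    by (simp add: algebra_simps)
  finally show ?case .
qed

end

lemma free_mult_conv_circle_probs:
  assumes "is_free_mult_conv T \<mu> \<nu> \<rho>"
  shows "\<mu> \<in> circle_probs" "\<nu> \<in> circle_probs" "\<rho> \<in> circle_probs"
  using assms by (auto simp: is_free_mult_conv_def star_prob_space.has_distribution_def)

text \<open>The bounds for words apply to \<open>X = U / M\<close> and \<open>W = (V - u) / 2\<close>, where \<open>U\<close> and \<open>V\<close> realize
  \<open>\<mu>\<close> and \<open>\<nu>\<close>; they are free because they lie in the algebras generated by \<open>U\<close> and \<open>V\<close>.\<close>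
lemma free_mult_conv_moments:
  fixes T :: "'a::ring_1 itself"
  assumes conv: "is_free_mult_conv T \<mu> \<nu> \<rho>" and K: "1 \<le> K" and M: "0 < M"
    and bound: "\<And>q. q < p \<Longrightarrow> cmod (circle_moment \<mu> q) \<le> K * M ^ q"
  shows "circle_moment \<rho> 1 = circle_moment \<nu> 1 * circle_moment \<mu> 1"
    and "cmod (circle_moment \<rho> p - circle_moment \<nu> 1 ^ p * circle_moment \<mu> p)
       \<le> 3 ^ p * 4 ^ (2 * p)\<^sup>2 * K ^ (2 * p) * spread \<nu> * M ^ p"
proof -
  obtain scale :: "complex \<Rightarrow> 'a \<Rightarrow> 'a" and star \<phi> U V where
    sps: "star_prob_space scale star \<phi>" and
    fr: "star_prob_space.freely_independent scale star \<phi> U V" and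
    U: "star_prob_space.has_distribution star \<phi> U \<mu>" and
    V: "star_prob_space.has_distribution star \<phi> V \<nu>" and
    UV: "star_prob_space.has_distribution star \<phi> (U * V) \<rho>"
    using conv unfolding is_free_mult_conv_def by blast
  interpret star_prob_space scale star \<phi> by (rule sps)
  have \<nu>: "\<nu> \<in> circle_probs" using free_mult_conv_circle_probs[OF conv] by blast
  define u where "u = circle_moment \<nu> 1"
  define X where "X = scale (1 / of_real M) U"
  define W where "W = scale (1 / 2) (V - scale u 1)"
  have u_le: "cmod u \<le> 1" using cmod_circle_moment_le[OF \<nu>] by (simp add: u_def)
  have V_eq: "scale u 1 + scale 2 W = V" by (simp add: W_def)
  have X_moment: "\<phi> (X ^ q) = circle_moment \<mu> q / of_real M ^ q" for q
    using moment_has_distribution[OF U] by (simp add: X_def scale_power state_scale power_divide)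
  have XV_moment: "\<phi> ((X * V) ^ q) = circle_moment \<rho> q / of_real M ^ q" for q
    using moment_has_distribution[OF UV]
    by (simp add: X_def scale_power state_scale scale_mult_left power_divide)
  have W_moment: "\<phi> (W ^ e) = (\<integral>t. ((t - u) / 2) ^ e \<partial>\<nu>)" for e
    using shifted_moment_has_distribution[OF V, of 0 u e]
    by (simp add: W_def scale_power state_scale power_divide)
  have "V + scale (- u) 1 \<in> star_alg_gen {V}"
    by (intro star_alg_gen.add star_alg_gen.scale star_alg_gen.one star_alg_gen.base) simp
  then have "W \<in> star_alg_gen {V}"
    unfolding W_def by (intro star_alg_gen.scale) simp
  moreover have "X \<in> star_alg_gen {U}" by (auto simp: X_def intro: star_alg_gen.intros)
  ultimately have free: "freely_independent X W"
    using freely_independent_subalgebra fr by blast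
  interpret free_word_bounds scale star \<phi> X W p K "spread \<nu> / 4"
  proof
    show "0 \<le> spread \<nu> / 4"
      using spread_nonneg[OF \<nu>] by simp
    show "spread \<nu> / 4 \<le> 1"
      by (rule order_trans[of _ "1 / 4"]) (simp_all add: spread_def)
    show "cmod (\<phi> (X ^ q)) \<le> K" if "q < p" for q
      using bound[OF that] M by (simp add: X_moment norm_divide norm_power divide_le_eq)
    show "cmod (\<phi> (W ^ e)) \<le> spread \<nu> / 4" if "0 < e" for e
      using centred_moment_bound[OF \<nu> that] by (simp add: W_moment u_def)
    have "\<phi> (V - scale u 1) = 0"
      using state_add[of "V - scale u 1" "scale u 1"] moment_has_distribution[OF V, of 1]
      by (simp add: state_scale state_one u_def)
    then show "\<phi> W = 0" by (simp add: W_def state_scale)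
  qed (use free K in auto)
  show "circle_moment \<rho> 1 = circle_moment \<nu> 1 * circle_moment \<mu> 1"
    using product_first_moment[of u] X_moment[of 1] XV_moment[of 1] M
    unfolding V_eq by (simp add: u_def)
  let ?C = "3 ^ p * 4 ^ (2 * p)\<^sup>2 * K ^ (2 * p) :: real"
  have "cmod (circle_moment \<rho> p - u ^ p * circle_moment \<mu> p) =
      cmod (\<phi> ((X * V) ^ p) - u ^ p * \<phi> (X ^ p)) * M ^ p"
  proof -
    have "circle_moment \<rho> p - u ^ p * circle_moment \<mu> p =
      (\<phi> ((X * V) ^ p) - u ^ p * \<phi> (X ^ p)) * of_real M ^ p"
      using M unfolding X_moment XV_moment by (simp add: field_simps)
    then show ?thesis using M by (simp add: norm_mult norm_power)
  qed
  also have "\<dots> \<le> ?C * (spread \<nu> / 4) * M ^ p"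
    using product_moment_bound[OF u_le] M unfolding V_eq by (intro mult_right_mono) auto
  also have "\<dots> \<le> ?C * spread \<nu> * M ^ p"
    using spread_nonneg[OF \<nu>] M K by (intro mult_right_mono mult_left_mono) auto
  finally show "cmod (circle_moment \<rho> p - circle_moment \<nu> 1 ^ p * circle_moment \<mu> p)
       \<le> ?C * spread \<nu> * M ^ p"
    by (simp add: u_def)
qed

lemma free_mult_conv_list_circle_probs:
  "is_free_mult_conv_list T \<mu>s \<rho> \<Longrightarrow> \<rho> \<in> circle_probs \<and> set \<mu>s \<subseteq> circle_probs"
  by (induction rule: is_free_mult_conv_list.induct) (auto dest: free_mult_conv_circle_probs)

lemma free_mult_conv_list_first_moment:
  "is_free_mult_conv_list T \<mu>s \<rho> \<Longrightarrow>
    circle_moment \<rho> 1 = prod_list (map (\<lambda>\<mu>. circle_moment \<mu> 1) \<mu>s)"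
proof (induction rule: is_free_mult_conv_list.induct)
  case (snoc \<mu>s \<rho> \<nu> \<sigma>)
  then show ?case using free_mult_conv_moments(1)[OF snoc(2), of 1 1 0] by simp
qed simp

definition total_spread :: "complex measure list \<Rightarrow> real" where
  "total_spread \<mu>s = sum_list (map spread \<mu>s)"

lemma total_spread_nonneg: "set \<mu>s \<subseteq> circle_probs \<Longrightarrow> 0 \<le> total_spread \<mu>s"
  by (auto simp: total_spread_def intro!: sum_list_nonneg spread_nonneg)

text \<open>\<open>\<bar>u\<bar>\<^sup>2 = 1 - spread \<le> exp (- spread)\<close> for each factor.\<close>
lemma first_moment_le_exp_spread:
  assumes "is_free_mult_conv_list T \<mu>s \<rho>"
  shows "cmod (circle_moment \<rho> 1) \<le> exp (- total_spread \<mu>s / 2)"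
proof -
  have *: "(cmod (prod_list (map (\<lambda>\<mu>. circle_moment \<mu> 1) \<mu>s)))\<^sup>2 \<le> exp (- total_spread \<mu>s)"
  proof (induction \<mu>s)
    case (Cons \<mu> \<mu>s)
    have "(cmod (circle_moment \<mu> 1))\<^sup>2 \<le> exp (- spread \<mu>)"
      using exp_ge_add_one_self[of "- spread \<mu>"] by (simp add: spread_def)
    then have "(cmod (circle_moment \<mu> 1))\<^sup>2 *
        (cmod (prod_list (map (\<lambda>\<mu>. circle_moment \<mu> 1) \<mu>s)))\<^sup>2 \<le>
        exp (- spread \<mu>) * exp (- total_spread \<mu>s)"
      using Cons by (intro mult_mono) auto
    then show ?case
      by (simp add: total_spread_def norm_mult power_mult_distrib flip: exp_add)
  qed (simp add: total_spread_def)
  have "(cmod (circle_moment \<rho> 1))\<^sup>2 \<le> (exp (- total_spread \<mu>s / 2))\<^sup>2"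
    using * unfolding free_mult_conv_list_first_moment[OF assms]
    by (simp flip: exp_double)
  then show ?thesis by (rule power2_le_imp_le) simp
qed

text \<open>Each convolution adds at most a constant times the spread of the new factor to the quotient of
  the \<open>p\<close>-th moment by the \<open>p\<close>-th power of the first moment. The constant is uniform along the list
  since the bound on the lower quotients is taken with the total spread. The lower bound \<open>1 / 2\<close>
  for the first moments is needed to pass from powers of the old first moment to powers of the
  new one.\<close>
lemma moment_ratio_step:
  fixes T :: "'a::ring_1 itself"
  assumes A: "1 \<le> A"
    and lower: "\<And>q \<mu>s \<rho>. q < p \<Longrightarrow> is_free_mult_conv_list T \<mu>s \<rho> \<Longrightarrow>
      \<forall>\<mu>\<in>set \<mu>s. 1 / 2 \<le> cmod (circle_moment \<mu> 1) \<Longrightarrow>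
      cmod (circle_moment \<rho> q) \<le> A * (1 + total_spread \<mu>s) ^ N * cmod (circle_moment \<rho> 1) ^ q"
    and conv: "is_free_mult_conv_list T \<mu>s \<rho>"
    and half: "\<forall>\<mu>\<in>set \<mu>s. 1 / 2 \<le> cmod (circle_moment \<mu> 1)"
    and S: "total_spread \<mu>s \<le> S"
  shows "cmod (circle_moment \<rho> p) \<le>
      (2 ^ p + 3 ^ p * 4 ^ (2 * p)\<^sup>2 * 2 ^ p * (A * (1 + S) ^ N) ^ (2 * p) * total_spread \<mu>s) *
      cmod (circle_moment \<rho> 1) ^ p"
  using conv half S
proof (induction rule: is_free_mult_conv_list.induct)
  case (single \<mu>)
  have S0: "0 \<le> S" using single spread_nonneg[of \<mu>] by (simp add: total_spread_def)
  have "1 \<le> (2 * cmod (circle_moment \<mu> 1)) ^ p"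
    using single by (intro one_le_power) simp
  then have "cmod (circle_moment \<mu> p) \<le> 2 ^ p * cmod (circle_moment \<mu> 1) ^ p"
    using cmod_circle_moment_le[OF single(1), of p] by (simp add: power_mult_distrib)
  also have "\<dots> \<le> (2 ^ p + 3 ^ p * 4 ^ (2 * p)\<^sup>2 * 2 ^ p * (A * (1 + S) ^ N) ^ (2 * p) *
      total_spread [\<mu>]) * cmod (circle_moment \<mu> 1) ^ p"
    using A S0 single spread_nonneg[of \<mu>]
    by (intro mult_right_mono) (auto simp: total_spread_def)
  finally show ?case .
next
  case (snoc \<mu>s \<rho> \<nu> \<sigma>)
  define K where "K = A * (1 + S) ^ N"
  define C where "C = 3 ^ p * 4 ^ (2 * p)\<^sup>2 * K ^ (2 * p)"
  define M where "M = cmod (circle_moment \<rho> 1)"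
  define u where "u = circle_moment \<nu> 1"
  note probs = free_mult_conv_circle_probs[OF snoc(2)]
  have \<mu>s: "set \<mu>s \<subseteq> circle_probs"
    using free_mult_conv_list_circle_probs[OF snoc(1)] by blast
  have tot: "total_spread (\<mu>s @ [\<nu>]) = total_spread \<mu>s + spread \<nu>"
    by (simp add: total_spread_def)
  have S: "0 \<le> total_spread \<mu>s" "total_spread \<mu>s \<le> S"
    using total_spread_nonneg[OF \<mu>s] spread_nonneg[OF probs(2)] snoc.prems tot by auto
  have K: "1 \<le> K"
    unfolding K_def using A S mult_mono[of 1 A 1 "(1 + S) ^ N"] by (simp add: one_le_power)
  have u: "1 / 2 \<le> cmod u" using snoc.prems by (simp add: u_def)
  have "circle_moment \<rho> 1 \<noteq> 0"
    using snoc.prems unfolding free_mult_conv_list_first_moment[OF snoc(1)]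
    by (auto simp: prod_list_zero_iff)
  then have M: "0 < M" by (simp add: M_def)
  have bound: "cmod (circle_moment \<rho> q) \<le> K * M ^ q" if "q < p" for q
  proof -
    have "cmod (circle_moment \<rho> q) \<le> A * (1 + total_spread \<mu>s) ^ N * M ^ q"
      using lower[OF that snoc(1)] snoc.prems by (simp add: M_def)
    also have "\<dots> \<le> K * M ^ q"
      unfolding K_def using A S M by (intro mult_right_mono mult_left_mono power_mono) auto
    finally show ?thesis .
  qed
  have first: "cmod (circle_moment \<sigma> 1) ^ p = cmod u ^ p * M ^ p"
    using free_mult_conv_moments(1)[OF snoc(2) K M bound]
    by (simp add: u_def M_def norm_mult power_mult_distrib)
  have IH: "cmod (circle_moment \<rho> p) \<le> (2 ^ p + C * 2 ^ p * total_spread \<mu>s) * M ^ p"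
    using snoc.IH snoc.prems S by (simp add: C_def K_def M_def ac_simps)
  have C: "0 \<le> C" using K by (simp add: C_def)
  have Mp: "M ^ p \<le> 2 ^ p * (cmod u ^ p * M ^ p)"
  proof -
    have "1 \<le> (2 * cmod u) ^ p" using u by (intro one_le_power) simp
    then have "1 * M ^ p \<le> (2 * cmod u) ^ p * M ^ p" using M by (intro mult_right_mono) auto
    then show ?thesis by (simp add: power_mult_distrib mult.assoc)
  qed
  have "cmod (circle_moment \<sigma> p) \<le>
      cmod (u ^ p * circle_moment \<rho> p) + cmod (circle_moment \<sigma> p - u ^ p * circle_moment \<rho> p)"
    by (rule norm_triangle_sub)
  also have "\<dots> \<le> cmod u ^ p * ((2 ^ p + C * 2 ^ p * total_spread \<mu>s) * M ^ p) +
      C * spread \<nu> * M ^ p"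
    using IH free_mult_conv_moments(2)[OF snoc(2) K M bound]
    by (intro add_mono) (simp_all add: norm_mult norm_power mult_left_mono C_def u_def)
  also have "\<dots> \<le> cmod u ^ p * ((2 ^ p + C * 2 ^ p * total_spread \<mu>s) * M ^ p) +
      C * spread \<nu> * (2 ^ p * (cmod u ^ p * M ^ p))"
    using Mp C spread_nonneg[OF probs(2)] by (intro add_left_mono mult_left_mono) auto
  also have "\<dots> = (2 ^ p + C * 2 ^ p * total_spread (\<mu>s @ [\<nu>])) * cmod (circle_moment \<sigma> 1) ^ p"
    unfolding first tot by (simp add: algebra_simps)
  finally show ?case by (simp add: C_def K_def ac_simps)
qed

text \<open>The exponent and the constant depend on the order of the moment, but not on the number of
  factors. Polynomial growth is essential: a factor exponential in the total spread could
  cancel the decay of the first moment.\<close>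
lemma free_mult_conv_list_moment_bound:
  fixes T :: "'a::ring_1 itself"
  shows "\<exists>A\<ge>1. \<exists>N. \<forall>q<p. \<forall>\<mu>s \<rho>. is_free_mult_conv_list T \<mu>s \<rho> \<longrightarrow>
      (\<forall>\<mu>\<in>set \<mu>s. 1 / 2 \<le> cmod (circle_moment \<mu> 1)) \<longrightarrow>
      cmod (circle_moment \<rho> q) \<le> A * (1 + total_spread \<mu>s) ^ N * cmod (circle_moment \<rho> 1) ^ q"
proof (induction p)
  case (Suc p)
  then obtain A N where A: "1 \<le> A" and lower: "\<And>q \<mu>s \<rho>. q < p \<Longrightarrow>
      is_free_mult_conv_list T \<mu>s \<rho> \<Longrightarrow> \<forall>\<mu>\<in>set \<mu>s. 1 / 2 \<le> cmod (circle_moment \<mu> 1) \<Longrightarrow>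
      cmod (circle_moment \<rho> q) \<le> A * (1 + total_spread \<mu>s) ^ N * cmod (circle_moment \<rho> 1) ^ q"
    by blast
  define D where "D = 3 ^ p * 4 ^ (2 * p)\<^sup>2 * 2 ^ p * A ^ (2 * p)"
  define A' where "A' = A + 2 ^ p + D"
  define N' where "N' = N + N * (2 * p) + 1"
  have D: "0 \<le> D" using A by (simp add: D_def)
  show ?case
  proof (intro exI[of _ A'] exI[of _ N'] conjI allI impI)
    show "1 \<le> A'" using A D by (simp add: A'_def add_increasing2)
    fix q \<mu>s \<rho>
    assume q: "q < Suc p" and conv: "is_free_mult_conv_list T \<mu>s \<rho>"
      and half: "\<forall>\<mu>\<in>set \<mu>s. 1 / 2 \<le> cmod (circle_moment \<mu> 1)"
    define S where "S = total_spread \<mu>s"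
    have S: "0 \<le> S"
      using free_mult_conv_list_circle_probs[OF conv] by (simp add: S_def total_spread_nonneg)
    have "\<exists>B. cmod (circle_moment \<rho> q) \<le> B * cmod (circle_moment \<rho> 1) ^ q \<and>
        B \<le> A' * (1 + S) ^ N'"
    proof (cases "q < p")
      case True
      have "A * (1 + S) ^ N \<le> A' * (1 + S) ^ N'"
        using A D S by (intro mult_mono power_increasing) (auto simp: A'_def N'_def)
      then show ?thesis using lower[OF True conv half] by (auto simp: S_def)
    next
      case False
      then have q: "q = p" using q by simp
      let ?B = "2 ^ p + 3 ^ p * 4 ^ (2 * p)\<^sup>2 * 2 ^ p * (A * (1 + S) ^ N) ^ (2 * p) * S"
      have "cmod (circle_moment \<rho> p) \<le> ?B * cmod (circle_moment \<rho> 1) ^ p"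
        using moment_ratio_step[OF A lower conv half, where S = S] by (simp add: S_def)
      moreover have "?B \<le> A' * (1 + S) ^ N'"
      proof -
        have "?B = 2 ^ p + D * ((1 + S) ^ (N * (2 * p)) * S)"
          by (simp add: D_def power_mult_distrib power_mult)
        also have "\<dots> \<le> 2 ^ p * (1 + S) ^ N' + D * (1 + S) ^ N'"
        proof (intro add_mono mult_left_mono D)
          show "(2::real) ^ p \<le> 2 ^ p * (1 + S) ^ N'" using S by (simp add: one_le_power)
          have "(1 + S) ^ (N * (2 * p)) * S \<le> (1 + S) ^ (N * (2 * p)) * (1 + S)"
            using S by (intro mult_left_mono) auto
          also have "\<dots> = (1 + S) ^ (N * (2 * p) + 1)" by simp
          also have "\<dots> \<le> (1 + S) ^ N'"
            using S by (intro power_increasing) (auto simp: N'_def)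
          finally show "(1 + S) ^ (N * (2 * p)) * S \<le> (1 + S) ^ N'" .
        qed
        also have "\<dots> = (2 ^ p + D) * (1 + S) ^ N'" by (simp add: algebra_simps)
        also have "\<dots> \<le> A' * (1 + S) ^ N'"
          using A S by (intro mult_right_mono) (auto simp: A'_def)
        finally show ?thesis .
      qed
      ultimately show ?thesis using q by blast
    qed
    then show "cmod (circle_moment \<rho> q) \<le>
        A' * (1 + total_spread \<mu>s) ^ N' * cmod (circle_moment \<rho> 1) ^ q"
      unfolding S_def[symmetric] by (meson mult_right_mono norm_ge_zero order_trans zero_le_power)
  qed
qed auto

section \<open>The Haar measure and weak convergence\<close>

lemma measurable_cis_uniform: "cis \<in> measurable (uniform_measure lborel A) circle_borel"
proof -
  have "cis \<in> borel_measurable borel"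
    by (intro borel_measurable_continuous_onI continuous_intros)
  then have "cis \<in> borel_measurable (uniform_measure lborel A)"
    by (subst measurable_cong_sets[of _ borel _ borel]) auto
  then show ?thesis
    unfolding circle_borel_def by (intro measurable_restrict_space2) auto
qed

lemma circle_haar_circle_probs: "circle_haar \<in> circle_probs"
proof -
  note cis = measurable_cis_uniform[of "{-pi<..pi}"]
  have "prob_space (uniform_measure lborel {-pi<..pi})"
    by (intro prob_space_uniform_measure) auto
  then have "prob_space circle_haar"
    unfolding circle_haar_def using cis by (intro prob_space.prob_space_distr)
  then show ?thesis
    by (simp add: circle_probs_def circle_haar_def) (simp add: circle_borel_def)
qed

lemma circle_haar_moment:
  assumes q: "0 < q"
  shows "circle_moment circle_haar q = 0"
proof -
  note cis = measurable_cis_uniform[of "{-pi<..pi}"]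
  have unif: "uniform_measure lborel {-pi<..pi} =
      density lborel (\<lambda>x. ennreal (indicator {-pi<..pi} x / (2 * pi)))"
    unfolding uniform_measure_def
    by (intro density_cong) (auto simp: indicator_def divide_ennreal simp flip: ennreal_1)
  have cis_power: "(\<lambda>x. cis x ^ q) \<in> borel_measurable borel"
    by (intro borel_measurable_continuous_onI continuous_intros)
  let ?F = "\<lambda>x::real. exp (\<i> * of_nat q * of_real x) / (\<i> * of_nat q)"
  have "circle_moment circle_haar q = (\<integral>x. cis x ^ q \<partial>uniform_measure lborel {-pi<..pi})"
    unfolding circle_moment_def circle_haar_def
    by (rule integral_distr[OF cis]) (auto simp: circle_borel_def intro!: measurable_restrict_space1)
  also have "\<dots> = (\<integral>x. (indicator {-pi<..pi} x / (2 * pi)) *\<^sub>R cis x ^ q \<partial>lborel)"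
    unfolding unif
    by (rule integral_density) (auto intro!: borel_measurable_continuous_onI continuous_intros)
  also have "\<dots> = (\<integral>x. (1 / (2 * pi)) *\<^sub>R (indicator {-pi..pi} x *\<^sub>R cis x ^ q) \<partial>lborel)"
  proof (rule integral_cong_AE)
    have "AE x in lborel. x \<noteq> -pi" by (rule AE_lborel_singleton)
    then show "AE x in lborel. (indicator {-pi<..pi} x / (2 * pi)) *\<^sub>R cis x ^ q =
        (1 / (2 * pi)) *\<^sub>R (indicator {-pi..pi} x *\<^sub>R cis x ^ q)"
      by eventually_elim (auto simp: indicator_def)
  qed (use cis_power in simp_all)
  also have "\<dots> = (1 / (2 * pi)) *\<^sub>R (\<integral>x. indicator {-pi..pi} x *\<^sub>R cis x ^ q \<partial>lborel)"
    by (rule integral_scaleR_right)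
  also have "(\<integral>x. indicator {-pi..pi} x *\<^sub>R cis x ^ q \<partial>lborel) = ?F pi - ?F (-pi)"
  proof (rule integral_FTC_atLeastAtMost)
    fix x :: real
    have "((\<lambda>z. exp (\<i> * of_nat q * z) / (\<i> * of_nat q)) has_field_derivative
        exp (\<i> * of_nat q * of_real x)) (at (of_real x))"
      by (rule derivative_eq_intros refl | use q in simp)+
    from has_vector_derivative_real_field[OF this, of "{-pi..pi}"]
    show "(?F has_vector_derivative cis x ^ q) (at x within {-pi..pi})"
      by (simp only: cis_conv_exp exp_of_nat_mult[symmetric] ac_simps)
  next
    show "continuous_on {-pi..pi} (\<lambda>x. cis x ^ q)" by (intro continuous_intros)
  qed simp
  also have "?F pi - ?F (-pi) = 0"
  proof -
    have "\<i> * of_nat q * of_real pi =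
        \<i> * of_nat q * of_real (-pi) + of_real (real_of_int (2 * int q) * pi) * \<i>"
      by simp
    then have "exp (\<i> * of_nat q * of_real pi) = exp (\<i> * of_nat q * of_real (-pi))"
      unfolding exp_eq by blast
    then show ?thesis by simp
  qed
  finally show ?thesis by simp
qed

lemma mixed_circle_moment:
  assumes \<mu>: "\<mu> \<in> circle_probs"
  shows "(\<integral>t. t ^ a * cnj t ^ b \<partial>\<mu>) =
     (if b \<le> a then circle_moment \<mu> (a - b) else cnj (circle_moment \<mu> (b - a)))"
proof -
  have unit: "t ^ n * cnj t ^ n = 1" if "cmod t = 1" for t n
    using that complex_norm_square[of t] by (simp flip: power_mult_distrib)
  show ?thesis
  proof (cases "b \<le> a")
    case True
    have "t ^ a * cnj t ^ b = t ^ (a - b)" if "cmod t = 1" for t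
    proof -
      have "t ^ a * cnj t ^ b = t ^ (a - b) * (t ^ b * cnj t ^ b)"
        using True by (simp only: mult.assoc[symmetric] power_add[symmetric] le_add_diff_inverse2)
      then show ?thesis using unit[OF that] by simp
    qed
    then have "(\<integral>t. t ^ a * cnj t ^ b \<partial>\<mu>) = (\<integral>t. t ^ (a - b) \<partial>\<mu>)"
      by (intro Bochner_Integration.integral_cong refl) (simp add: circle_space[OF \<mu>])
    then show ?thesis using True by (simp add: circle_moment_def)
  next
    case False
    have "t ^ a * cnj t ^ b = cnj (t ^ (b - a))" if "cmod t = 1" for t
    proof -
      have "t ^ a * cnj t ^ b = (t ^ a * cnj t ^ a) * cnj t ^ (b - a)"
        using False by (simp add: mult.assoc flip: power_add)
      then show ?thesis using unit[OF that] by simp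
    qed
    then have "(\<integral>t. t ^ a * cnj t ^ b \<partial>\<mu>) = (\<integral>t. cnj (t ^ (b - a)) \<partial>\<mu>)"
      by (intro Bochner_Integration.integral_cong refl) (simp add: circle_space[OF \<mu>])
    then show ?thesis using False by (simp add: circle_moment_def del: complex_cnj_power)
  qed
qed

text \<open>By the Stone--Weierstrass theorem it suffices to test with real polynomials in the real and
  imaginary part. The property \<open>P\<close> of a test function is stable under multiplication by \<open>t\<close> and
  its conjugate, and so under multiplication by any such polynomial.\<close>
lemma weak_conv_if_moments_tendsto:
  assumes \<rho>: "\<And>n. \<rho> n \<in> circle_probs" and \<mu>: "\<mu> \<in> circle_probs"
    and moments: "\<And>q. (\<lambda>n. circle_moment (\<rho> n) q) \<longlonglongrightarrow> circle_moment \<mu> q"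
  shows "circle_weak_conv \<rho> \<mu>"
proof -
  define P :: "(complex \<Rightarrow> complex) \<Rightarrow> bool" where "P h \<longleftrightarrow> continuous_on UNIV h \<and>
    (\<forall>a b. (\<lambda>n. \<integral>t. h t * (t ^ a * cnj t ^ b) \<partial>\<rho> n) \<longlonglongrightarrow> (\<integral>t. h t * (t ^ a * cnj t ^ b) \<partial>\<mu>))"
    for h
  have int: "integrable M (\<lambda>t. h t * (t ^ a * cnj t ^ b))"
    if "M \<in> circle_probs" "continuous_on UNIV h" for M h a b
    using that by (intro integrable_circle_continuous continuous_intros)
      (auto intro: continuous_on_subset)
  have P_1: "P (\<lambda>t. 1)"
    using moments by (auto simp: P_def mixed_circle_moment \<rho> \<mu> intro!: tendsto_intros)
  have P_add: "P (\<lambda>t. g t + h t)" if "P g" "P h" for g h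
    using that unfolding P_def
    by (auto simp: distrib_right int \<rho> \<mu> intro!: continuous_intros tendsto_add)
  have P_const: "P (\<lambda>t. c * h t)" if "P h" for c h
    using that unfolding P_def by (auto simp: mult.assoc intro!: continuous_intros tendsto_mult)
  have P_id: "P (\<lambda>t. t * h t)" if "P h" for h
  proof -
    have "(\<lambda>n. \<integral>t. t * h t * (t ^ a * cnj t ^ b) \<partial>\<rho> n) \<longlonglongrightarrow> (\<integral>t. t * h t * (t ^ a * cnj t ^ b) \<partial>\<mu>)"
      for a b
      using that[unfolded P_def, THEN conjunct2, rule_format, of "Suc a" b]
      by (simp add: ac_simps)
    then show ?thesis using that by (auto simp: P_def intro!: continuous_intros)
  qed
  have P_cnj: "P (\<lambda>t. cnj t * h t)" if "P h" for h
  proof -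
    have "(\<lambda>n. \<integral>t. cnj t * h t * (t ^ a * cnj t ^ b) \<partial>\<rho> n) \<longlonglongrightarrow>
        (\<integral>t. cnj t * h t * (t ^ a * cnj t ^ b) \<partial>\<mu>)" for a b
      using that[unfolded P_def, THEN conjunct2, rule_format, of a "Suc b"]
      by (simp add: ac_simps)
    then show ?thesis using that by (auto simp: P_def intro!: continuous_intros)
  qed
  have poly: "P h \<Longrightarrow> P (\<lambda>t. of_real (g t) * h t)" if "real_polynomial_function g" for g h
    using that
  proof (induction g arbitrary: h)
    case lin: (linear g)
    interpret bounded_linear g by (rule lin(1))
    have g: "complex_of_real (g t) = of_real (g 1) * ((t + cnj t) / 2) + of_real (g \<i>) * ((t - cnj t) / (2 * \<i>))"
      for t
    proof -
      have "g t = g (Re t *\<^sub>R 1 + Im t *\<^sub>R \<i>)"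
        by (rule arg_cong[of _ _ g]) (simp add: complex_eq_iff)
      also have "\<dots> = Re t * g 1 + Im t * g \<i>" by (simp only: add scaleR real_scaleR_def)
      finally have "complex_of_real (g t) = of_real (g 1) * of_real (Re t) + of_real (g \<i>) * of_real (Im t)"
        by simp
      moreover have "(t + cnj t) / 2 = of_real (Re t)" "(t - cnj t) / (2 * \<i>) = of_real (Im t)"
        unfolding complex_add_cnj complex_diff_cnj by (simp_all add: field_simps)
      ultimately show ?thesis by simp
    qed
    have "of_real (g t) * h t = (of_real (g 1) / 2 + of_real (g \<i>) / (2 * \<i>)) * (t * h t)
        + (of_real (g 1) / 2 - of_real (g \<i>) / (2 * \<i>)) * (cnj t * h t)" for t
      unfolding g[of t] by (simp add: algebra_simps add_divide_distrib diff_divide_distrib)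
    then have "(\<lambda>t. of_real (g t) * h t) = (\<lambda>t. (of_real (g 1) / 2 + of_real (g \<i>) / (2 * \<i>)) * (t * h t)
        + (of_real (g 1) / 2 - of_real (g \<i>) / (2 * \<i>)) * (cnj t * h t))"
      by (rule ext)
    then show ?case
      using P_add[OF P_const[OF P_id[OF lin(2)]] P_const[OF P_cnj[OF lin(2)]]] by (simp only:)
  next
    case (add f g)
    then show ?case using P_add by (simp add: distrib_right)
  next
    case (mult f g)
    then show ?case by (simp add: mult.assoc)
  qed (use P_const in auto)
  show ?thesis
    unfolding circle_weak_conv_def
  proof (intro allI impI LIMSEQ_I)
    fix f :: "complex \<Rightarrow> real" and r :: real
    assume f: "continuous_on (sphere 0 1) f" and r: "0 < r"
    obtain g where g: "real_polynomial_function g"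
      and close: "\<And>t. t \<in> sphere 0 1 \<Longrightarrow> \<bar>f t - g t\<bar> < r / 3"
      using Stone_Weierstrass_real_polynomial_function[OF _ f, of "r / 3"] r by auto
    have g_cont: "continuous_on (sphere 0 1) g"
      using g real_polynomial_function_eq continuous_on_polymonial_function by blast
    have approx: "\<bar>(\<integral>t. f t \<partial>M) - (\<integral>t. g t \<partial>M)\<bar> \<le> r / 3" if M: "M \<in> circle_probs" for M
    proof -
      have "\<bar>\<integral>t. f t - g t \<partial>M\<bar> \<le> (\<integral>t. r / 3 \<partial>M)"
        using close f g_cont
        by (intro norm_circle_integral_le[OF M, where 'b = real, simplified real_norm_def]
            integrable_circle_continuous M continuous_intros) (auto intro: less_imp_le)
      then show ?thesis
        using prob_space.prob_space[OF circle_prob_space[OF M]] f g_cont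
        by (simp add: integrable_circle_continuous M)
    qed
    have "P (\<lambda>t. of_real (g t))" using poly[OF g P_1] by simp
    then have "(\<lambda>n. complex_of_real (\<integral>t. g t \<partial>\<rho> n)) \<longlonglongrightarrow> of_real (\<integral>t. g t \<partial>\<mu>)"
      unfolding P_def by (elim conjE allE[of _ 0]) simp
    then have "(\<lambda>n. \<integral>t. g t \<partial>\<rho> n) \<longlonglongrightarrow> (\<integral>t. g t \<partial>\<mu>)"
      using tendsto_of_real_iff by blast
    then obtain N where N: "\<And>n. n \<ge> N \<Longrightarrow> \<bar>(\<integral>t. g t \<partial>\<rho> n) - (\<integral>t. g t \<partial>\<mu>)\<bar> < r / 3"
      using LIMSEQ_D[of _ _ "r / 3"] r by fastforce
    show "\<exists>N. \<forall>n\<ge>N. norm ((\<integral>t. f t \<partial>\<rho> n) - (\<integral>t. f t \<partial>\<mu>)) < r"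
    proof (intro exI[of _ N] allI impI)
      fix n assume "n \<ge> N"
      then show "norm ((\<integral>t. f t \<partial>\<rho> n) - (\<integral>t. f t \<partial>\<mu>)) < r"
        using N[of n] approx[OF \<rho>[of n]] approx[OF \<mu>] unfolding real_norm_def by linarith
    qed
  qed
qed

section \<open>Centring\<close>

lemma borel_measurable_Arg [measurable]: "Arg \<in> borel_measurable borel"
proof -
  have cont: "(\<lambda>t. indicat_real (- \<real>\<^sub>\<le>\<^sub>0) t *\<^sub>R Arg t) \<in> borel_measurable borel"
    by (intro borel_measurable_continuous_on_indicator continuous_at_imp_continuous_on ballI
        continuous_at_Arg) auto
  have "(\<lambda>t. if t \<in> \<real>\<^sub>\<le>\<^sub>0 then pi else indicat_real (- \<real>\<^sub>\<le>\<^sub>0) t *\<^sub>R Arg t) \<in> borel_measurable borel"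
    (is "?f \<in> _") by (rule measurable_If_set[OF _ cont]) auto
  then have "(\<lambda>t. if t = 0 then Arg 0 else ?f t) \<in> borel_measurable borel"
    by measurable
  also have "(\<lambda>t. if t = 0 then Arg 0 else ?f t) = Arg"
  proof
    fix t :: complex
    consider "t = 0" | "t \<noteq> 0" "t \<in> \<real>\<^sub>\<le>\<^sub>0" | "t \<noteq> 0" "t \<notin> \<real>\<^sub>\<le>\<^sub>0" by blast
    then show "(if t = 0 then Arg 0 else ?f t) = Arg t"
    proof cases
      case 2
      then have "Arg t = pi"
        unfolding complex_nonpos_Reals_iff Arg_eq_pi
        by (metis complex_eq_iff less_eq_real_def zero_complex.sel)
      then show ?thesis using 2 by simp
    qed simp_all
  qed
  finally show ?thesis .
qed

lemma cis_Arg_circle: "cmod t = 1 \<Longrightarrow> cis (Arg t) = t"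
  by (subst cis_Arg) (auto simp: sgn_div_norm)

lemma norm_cis_minus_one: "cmod (cis s - 1) \<le> \<bar>s\<bar>"
proof -
  have "cmod (cis s - 1) = 2 * \<bar>sin (s / 2)\<bar>"
    using dist_exp_i_1[of s] by (simp add: cis_conv_exp)
  then show ?thesis using abs_sin_x_le_abs_x[of "s / 2"] by simp
qed

lemma abs_sin_minus_le_square: "\<bar>sin s - s\<bar> \<le> s\<^sup>2" for s :: real
proof -
  have "\<bar>sin s - s\<bar> \<le> s\<^sup>2 / 2"
    using Maclaurin_sin_bound[of s 2] by (simp add: eval_nat_numeral sin_coeff_def)
  then show ?thesis using zero_le_power2[of s] by linarith
qed

text \<open>The constant comes from \<open>sin z \<ge> z / 3\<close> on \<open>[0, 2]\<close>, applied to \<open>z = \<bar>s\<bar> / 2\<close>.\<close>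
lemma square_le_one_minus_cos:
  fixes s :: real
  assumes "\<bar>s\<bar> \<le> pi"
  shows "s\<^sup>2 \<le> 18 * (1 - cos s)"
proof -
  define z where "z = \<bar>s / 2\<bar>"
  have z: "0 \<le> z" "z \<le> 2" using assms pi_less_4 by (auto simp: z_def)
  have "\<bar>sin z - z\<bar> \<le> z ^ 3 / 6"
    using Maclaurin_sin_bound[of z 3] z by (simp add: eval_nat_numeral sin_coeff_def)
  moreover have "z ^ 3 \<le> 4 * z"
    using z mult_mono[of "z\<^sup>2" "2\<^sup>2" z z] power_mono[of z 2 2]
    by (simp add: power3_eq_cube power2_eq_square)
  ultimately have "z / 3 \<le> sin z" by linarith
  then have "(z / 3)\<^sup>2 \<le> (sin z)\<^sup>2" using z by (intro power_mono) auto
  moreover have "cos s = 1 - 2 * (sin z)\<^sup>2"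
  proof -
    have "cos s = cos (2 * z)" by (simp add: z_def abs_if)
    then show ?thesis by (simp only: cos_double_sin)
  qed
  ultimately show ?thesis by (simp add: z_def power_divide)
qed

lemma integrable_circle_bounded:
  fixes f :: "complex \<Rightarrow> 'b::{banach, second_countable_topology}"
  assumes \<mu>: "\<mu> \<in> circle_probs" and f: "f \<in> borel_measurable borel"
    and B: "\<And>t. cmod t = 1 \<Longrightarrow> norm (f t) \<le> B"
  shows "integrable \<mu> f"
proof -
  interpret prob_space \<mu> using circle_prob_space[OF \<mu>] .
  show ?thesis
    using B by (intro integrable_const_bound[of _ B] borel_measurable_circle[OF \<mu> f])
      (auto simp: circle_space[OF \<mu>])
qed

definition centering_arg :: "real \<Rightarrow> complex measure \<Rightarrow> real" where
  "centering_arg \<tau> \<nu> = (\<integral>t. (if \<bar>Arg t\<bar> < \<tau> then Arg t else 0) \<partial>\<nu>)"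

definition centred_defect :: "real \<Rightarrow> complex measure \<Rightarrow> real" where
  "centred_defect \<tau> \<nu> = (\<integral>t. (1 - Re t) \<partial>(centered \<tau> \<nu>))"

lemma abs_Arg_le_pi: "\<bar>Arg t\<bar> \<le> pi"
  using Arg_bounded[of t] by linarith

lemma centering_const_eq_cis:
  assumes \<nu>: "\<nu> \<in> circle_probs"
  shows "centering_const \<tau> \<nu> = cis (centering_arg \<tau> \<nu>)"
proof -
  let ?f = "\<lambda>t. if \<bar>Arg t\<bar> < \<tau> then Arg t else 0"
  have Ln: "Ln t = \<i> * of_real (Arg t)" if "cmod t = 1" for t
    using that by (subst Ln_Arg) auto
  have "(LINT t:{t \<in> sphere 0 1. \<bar>Arg t\<bar> < \<tau>}|\<nu>. Ln t) = (\<integral>t. \<i> * complex_of_real (?f t) \<partial>\<nu>)"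
    unfolding set_lebesgue_integral_def
    by (intro Bochner_Integration.integral_cong refl)
       (auto simp: circle_space[OF \<nu>] indicator_def Ln)
  also have "\<dots> = \<i> * of_real (centering_arg \<tau> \<nu>)"
    unfolding centering_arg_def integral_mult_right_zero integral_complex_of_real ..
  finally show ?thesis by (simp add: centering_const_def cis_conv_exp)
qed

lemma centred_quotient:
  assumes "cmod t = 1"
  shows "t / cis \<beta> = cis (Arg t - \<beta>)"
  using cis_Arg_circle[OF assms] cis_divide[of "Arg t" \<beta>] by simp

lemma centred_defect_eq:
  assumes \<nu>: "\<nu> \<in> circle_probs"
  shows "centred_defect \<tau> \<nu> = (\<integral>t. 1 - cos (Arg t - centering_arg \<tau> \<nu>) \<partial>\<nu>)"
proof -
  let ?b = "cis (centering_arg \<tau> \<nu>)"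
  have "(\<lambda>t. t / ?b) \<in> borel_measurable \<nu>"
    by (intro borel_measurable_circle[OF \<nu>]) simp
  then have m: "(\<lambda>t. t / ?b) \<in> measurable \<nu> circle_borel"
    unfolding circle_borel_def
    by (intro measurable_restrict_space2) (auto simp: circle_space[OF \<nu>] norm_divide)
  have "centred_defect \<tau> \<nu> = (\<integral>t. 1 - Re (t / ?b) \<partial>\<nu>)"
    unfolding centred_defect_def centered_def centering_const_eq_cis[OF \<nu>]
    by (rule integral_distr[OF m]) (auto simp: circle_borel_def intro!: measurable_restrict_space1)
  also have "\<dots> = (\<integral>t. 1 - cos (Arg t - centering_arg \<tau> \<nu>) \<partial>\<nu>)"
    by (intro Bochner_Integration.integral_cong refl)
       (simp add: circle_space[OF \<nu>] centred_quotient)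
  finally show ?thesis .
qed

lemma centred_defect_nonneg: "\<nu> \<in> circle_probs \<Longrightarrow> 0 \<le> centred_defect \<tau> \<nu>"
  by (simp add: centred_defect_eq)

text \<open>A rotation does not change the modulus of the first moment, so the spread can be computed from
  the real part \<open>1 - y\<close> and the imaginary part of the first moment of the centred measure.\<close>
lemma spread_centred:
  assumes \<nu>: "\<nu> \<in> circle_probs"
  shows "spread \<nu> = 1 - (1 - centred_defect \<tau> \<nu>)\<^sup>2 -
    (\<integral>t. sin (Arg t - centering_arg \<tau> \<nu>) \<partial>\<nu>)\<^sup>2"
proof -
  interpret prob_space \<nu> using circle_prob_space[OF \<nu>] .
  define \<beta> where "\<beta> = centering_arg \<tau> \<nu>"
  define w where "w = circle_moment \<nu> 1 / cis \<beta>"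
  have int: "integrable \<nu> (\<lambda>t. t / cis \<beta>)"
    by (intro integrable_circle_continuous[OF \<nu>] continuous_intros) auto
  have w: "w = (\<integral>t. t / cis \<beta> \<partial>\<nu>)"
    by (simp add: w_def circle_moment_def)
  have "Re w = (\<integral>t. cos (Arg t - \<beta>) \<partial>\<nu>)"
    unfolding w integral_Re[OF int, symmetric]
    by (intro Bochner_Integration.integral_cong refl) (simp add: circle_space[OF \<nu>] centred_quotient)
  also have "\<dots> = 1 - centred_defect \<tau> \<nu>"
  proof -
    have "integrable \<nu> (\<lambda>t. cos (Arg t - \<beta>))"
      by (rule integrable_circle_bounded[OF \<nu>, of _ 1]) auto
    then show ?thesis using prob_space by (simp add: centred_defect_eq[OF \<nu>] \<beta>_def)
  qed
  finally have Re: "Re w = 1 - centred_defect \<tau> \<nu>" .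
  have Im: "Im w = (\<integral>t. sin (Arg t - \<beta>) \<partial>\<nu>)"
    unfolding w integral_Im[OF int, symmetric]
    by (intro Bochner_Integration.integral_cong refl) (simp add: circle_space[OF \<nu>] centred_quotient)
  have "cmod (circle_moment \<nu> 1) = cmod w" by (simp add: w_def norm_divide)
  then have "spread \<nu> = 1 - ((Re w)\<^sup>2 + (Im w)\<^sup>2)" by (simp add: spread_def cmod_power2)
  then show ?thesis unfolding Re Im \<beta>_def by simp
qed

lemma spread_le_centred_defect:
  assumes "\<nu> \<in> circle_probs"
  shows "spread \<nu> \<le> 2 * centred_defect \<tau> \<nu>"
proof -
  have "spread \<nu> \<le> 1 - (1 - centred_defect \<tau> \<nu>)\<^sup>2"
    using spread_centred[OF assms, of \<tau>] by simp
  also have "\<dots> \<le> 2 * centred_defect \<tau> \<nu>"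
    by (simp add: power2_eq_square algebra_simps)
  finally show ?thesis .
qed

lemma integral_Arg_tail:
  assumes \<nu>: "\<nu> \<in> circle_probs"
  shows "(\<integral>t. (if \<bar>Arg t\<bar> \<ge> \<epsilon> then 1 else 0 :: real) \<partial>\<nu>) =
      measure \<nu> {t \<in> sphere 0 1. \<bar>Arg t\<bar> \<ge> \<epsilon>}"
proof -
  have "(\<lambda>t. if \<bar>Arg t\<bar> \<ge> \<epsilon> then 1 else 0 :: real) = indicator {t. \<bar>Arg t\<bar> \<ge> \<epsilon>}"
    by (auto simp: indicator_def)
  then show ?thesis by (simp add: circle_space[OF \<nu>] Int_def conj_commute)
qed

lemma integrable_centred_cosine:
  assumes \<nu>: "\<nu> \<in> circle_probs"
  shows "integrable \<nu> (\<lambda>t. 1 - cos (Arg t - b))"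
proof (rule integrable_circle_bounded[OF \<nu>])
  show "norm (1 - cos (Arg t - b)) \<le> 2" for t
    using cos_ge_minus_one[of "Arg t - b"] cos_le_one[of "Arg t - b"]
    unfolding real_norm_def by linarith
qed simp

lemma
  assumes \<nu>: "\<nu> \<in> circle_probs" and \<epsilon>: "0 < \<epsilon>"
    and tail: "measure \<nu> {t \<in> sphere 0 1. \<bar>Arg t\<bar> \<ge> \<epsilon>} < \<epsilon>"
  shows abs_centering_arg_small: "\<bar>centering_arg \<tau> \<nu>\<bar> \<le> 5 * \<epsilon>"
    and centred_defect_small: "centred_defect \<tau> \<nu> \<le> 8 * \<epsilon>"
proof -
  interpret prob_space \<nu> using circle_prob_space[OF \<nu>] .
  let ?T = "\<lambda>t. if \<bar>Arg t\<bar> \<ge> \<epsilon> then 1 else 0 :: real"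
  have T: "integrable \<nu> ?T"
    by (rule integrable_circle_bounded[OF \<nu>, of _ 1]) auto
  have int_T: "(\<integral>t. a + b * ?T t \<partial>\<nu>) \<le> a + b * \<epsilon>" if "0 \<le> b" for a b
    using T tail that prob_space by (simp add: integral_Arg_tail[OF \<nu>] mult_left_mono del: mult_minus_right)
  have "norm (\<integral>t. (if \<bar>Arg t\<bar> < \<tau> then Arg t else 0) \<partial>\<nu>) \<le> (\<integral>t. \<epsilon> + 4 * ?T t \<partial>\<nu>)"
  proof (rule norm_circle_integral_le[OF \<nu>])
    show "integrable \<nu> (\<lambda>t. if \<bar>Arg t\<bar> < \<tau> then Arg t else 0)"
      using abs_Arg_le_pi by (intro integrable_circle_bounded[OF \<nu>, of _ pi]) auto
    fix t
    show "norm (if \<bar>Arg t\<bar> < \<tau> then Arg t else 0) \<le> \<epsilon> + 4 * ?T t"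
      using abs_Arg_le_pi[of t] pi_less_4 \<epsilon> by auto
  qed (use T in auto)
  also have "\<dots> \<le> \<epsilon> + 4 * \<epsilon>" by (rule int_T) simp
  finally show \<beta>: "\<bar>centering_arg \<tau> \<nu>\<bar> \<le> 5 * \<epsilon>" by (simp add: centering_arg_def)
  let ?\<beta> = "centering_arg \<tau> \<nu>"
  have "centred_defect \<tau> \<nu> \<le> (\<integral>t. 6 * \<epsilon> + 2 * ?T t \<partial>\<nu>)"
    unfolding centred_defect_eq[OF \<nu>]
  proof (rule integral_mono)
    show "integrable \<nu> (\<lambda>t. 1 - cos (Arg t - ?\<beta>))"
      by (rule integrable_centred_cosine[OF \<nu>])
    fix t
    have "1 - cos (Arg t - ?\<beta>) \<le> cmod (cis (Arg t - ?\<beta>) - 1)"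
      using abs_Re_le_cmod[of "cis (Arg t - ?\<beta>) - 1"] by simp
    also have "\<dots> \<le> \<bar>Arg t - ?\<beta>\<bar>" by (rule norm_cis_minus_one)
    finally have le: "1 - cos (Arg t - ?\<beta>) \<le> \<bar>Arg t - ?\<beta>\<bar>" .
    show "1 - cos (Arg t - ?\<beta>) \<le> 6 * \<epsilon> + 2 * ?T t"
    proof (cases "\<bar>Arg t\<bar> \<ge> \<epsilon>")
      case True
      then show ?thesis
        using cos_ge_minus_one[of "Arg t - ?\<beta>"] \<epsilon> unfolding if_P[OF True] by linarith
    next
      case False
      then show ?thesis
        using le \<beta> unfolding if_not_P[OF False] by linarith
    qed
  qed (use T in auto)
  also have "\<dots> \<le> 6 * \<epsilon> + 2 * \<epsilon>" by (rule int_T) simp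
  finally show "centred_defect \<tau> \<nu> \<le> 8 * \<epsilon>" by simp
qed

lemma cos_le_away_from_zero:
  assumes "0 \<le> a" "a \<le> \<bar>s\<bar>" "\<bar>s\<bar> \<le> 2 * pi - a"
  shows "cos s \<le> cos a"
proof (cases "\<bar>s\<bar> \<le> pi")
  case True
  then have "cos \<bar>s\<bar> \<le> cos a" using assms by (intro cos_monotone_0_pi_le) auto
  then show ?thesis by simp
next
  case False
  then have "cos (2 * pi - \<bar>s\<bar>) \<le> cos a" using assms by (intro cos_monotone_0_pi_le) auto
  moreover have "cos (2 * pi - \<bar>s\<bar>) = cos s" by (simp add: cos_diff)
  ultimately show ?thesis by simp
qed

text \<open>Let \<open>h\<close> be the argument truncated at \<open>\<tau>\<close>, and let \<open>b\<close> be its mean, the centring angle. As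
  \<open>h - b\<close> has mean \<open>0\<close>, it may be subtracted from the sine. Where the argument is below \<open>\<tau>\<close> this
  leaves \<open>sin s - s\<close>, of order \<open>s\<^sup>2\<close> and hence of order \<open>1 - cos s\<close>. Elsewhere the difference is only
  bounded, but there \<open>s\<close> stays away from the multiples of \<open>2 \<pi>\<close> and \<open>1 - cos s\<close> is bounded below.\<close>
lemma centred_sine_bound:
  assumes \<nu>: "\<nu> \<in> circle_probs" and \<tau>: "0 < \<tau>" "\<tau> < pi"
    and \<beta>: "\<bar>centering_arg \<tau> \<nu>\<bar> \<le> \<tau> / 2" "\<bar>centering_arg \<tau> \<nu>\<bar> \<le> (pi - \<tau>) / 2"
  shows "\<bar>\<integral>t. sin (Arg t - centering_arg \<tau> \<nu>) \<partial>\<nu>\<bar> \<le>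
      (18 + 5 / (1 - cos (\<tau> / 2))) * centred_defect \<tau> \<nu>"
proof -
  interpret prob_space \<nu> using circle_prob_space[OF \<nu>] .
  define b where "b = centering_arg \<tau> \<nu>"
  define d where "d = 1 - cos (\<tau> / 2)"
  let ?h = "\<lambda>t. if \<bar>Arg t\<bar> < \<tau> then Arg t else 0"
  have d: "0 < d"
    using cos_monotone_0_pi[of 0 "\<tau> / 2"] \<tau> by (simp add: d_def)
  have h: "integrable \<nu> ?h"
    using abs_Arg_le_pi by (intro integrable_circle_bounded[OF \<nu>, of _ pi]) auto
  have s: "integrable \<nu> (\<lambda>t. sin (Arg t - b))"
    by (rule integrable_circle_bounded[OF \<nu>, of _ 1]) auto
  have c: "integrable \<nu> (\<lambda>t. 1 - cos (Arg t - b))"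
    by (rule integrable_centred_cosine[OF \<nu>])
  have "(\<integral>t. ?h t - b \<partial>\<nu>) = 0"
    using h prob_space by (simp add: b_def centering_arg_def)
  then have "(\<integral>t. sin (Arg t - b) \<partial>\<nu>) = (\<integral>t. sin (Arg t - b) - (?h t - b) \<partial>\<nu>)"
    using h s by (subst Bochner_Integration.integral_diff) auto
  also have "norm \<dots> \<le> (\<integral>t. (18 + 5 / d) * (1 - cos (Arg t - b)) \<partial>\<nu>)"
  proof (rule norm_circle_integral_le[OF \<nu>])
    fix t
    define x where "x = Arg t - b"
    have x1: "0 \<le> 1 - cos x" by simp
    show "norm (sin (Arg t - b) - (?h t - b)) \<le> (18 + 5 / d) * (1 - cos (Arg t - b))"
    proof (cases "\<bar>Arg t\<bar> < \<tau>")
      case True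
      then have "\<bar>x\<bar> \<le> pi" using \<beta> \<tau> by (auto simp: x_def b_def)
      then have "\<bar>sin x - x\<bar> \<le> 18 * (1 - cos x)"
        using square_le_one_minus_cos[of x] abs_sin_minus_le_square[of x] by linarith
      also have "\<dots> \<le> (18 + 5 / d) * (1 - cos x)"
        using d x1 by (intro mult_right_mono) auto
      finally show ?thesis using True by (simp add: x_def)
    next
      case False
      then have "\<tau> / 2 \<le> \<bar>x\<bar>" "\<bar>x\<bar> \<le> 2 * pi - \<tau> / 2"
        using \<beta> \<tau> abs_Arg_le_pi[of t] unfolding x_def b_def by linarith+
      then have "cos x \<le> cos (\<tau> / 2)"
        using \<tau> by (intro cos_le_away_from_zero) auto
      then have "5 / d * d \<le> 5 / d * (1 - cos x)"
        using d by (intro mult_left_mono) (auto simp: d_def)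
      then have "5 \<le> 5 / d * (1 - cos x)" using d by simp
      also have "\<dots> \<le> (18 + 5 / d) * (1 - cos x)"
        using x1 by (intro mult_right_mono) auto
      finally have "5 \<le> (18 + 5 / d) * (1 - cos x)" .
      moreover have "\<bar>sin x + b\<bar> \<le> 5"
        using \<beta> \<tau> pi_less_4 abs_sin_le_one[of x] unfolding b_def by linarith
      ultimately show ?thesis using False by (simp add: x_def)
    qed
  qed (use h s c in auto)
  also have "\<dots> = (18 + 5 / d) * centred_defect \<tau> \<nu>"
    by (simp add: centred_defect_eq[OF \<nu>] b_def)
  finally show ?thesis by (simp add: b_def d_def)
qed

text \<open>With \<open>\<bar>v\<bar> \<le> L y\<close> the spread is at least \<open>2 y - (1 + L\<^sup>2) y\<^sup>2\<close>, which is at least \<open>y\<close> as soon as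
  \<open>(1 + L\<^sup>2) y \<le> 1\<close>.\<close>
lemma centred_defect_le_spread:
  assumes \<tau>: "0 < \<tau>" "\<tau> < pi"
  shows "\<exists>\<epsilon>>0. \<forall>\<nu>\<in>circle_probs. measure \<nu> {t \<in> sphere 0 1. \<bar>Arg t\<bar> \<ge> \<epsilon>} < \<epsilon> \<longrightarrow>
      spread \<nu> \<le> 1 / 2 \<and> centred_defect \<tau> \<nu> \<le> spread \<nu>"
proof -
  define L where "L = 18 + 5 / (1 - cos (\<tau> / 2))"
  \<comment> \<open>A tail bound by \<open>\<epsilon>\<close> makes the centring angle at most \<open>5 \<epsilon>\<close> and the defect at most \<open>8 \<epsilon>\<close>.
    The first two bounds on \<open>\<epsilon>\<close> admit \<open>centred_sine_bound\<close>, the third gives spread at most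
    \<open>1 / 2\<close>, and \<open>\<delta>\<close> gives \<open>(1 + L\<^sup>2) y \<le> 1\<close>.\<close>
  define \<delta> where "\<delta> = 1 / (1 + L\<^sup>2) / 8"
  define \<epsilon> where "\<epsilon> = min (min (\<tau> / 10) ((pi - \<tau>) / 10)) (min (1 / 32) \<delta>)"
  have L: "0 < 1 + L\<^sup>2" by (simp add: add_pos_nonneg)
  have \<delta>: "0 < \<delta>" using L by (simp add: \<delta>_def)
  have \<epsilon>: "0 < \<epsilon>" "\<epsilon> \<le> \<tau> / 10" "\<epsilon> \<le> (pi - \<tau>) / 10" "\<epsilon> \<le> 1 / 32" "\<epsilon> \<le> \<delta>"
    using \<tau> \<delta> by (auto simp: \<epsilon>_def min_def)
  have "spread \<nu> \<le> 1 / 2 \<and> centred_defect \<tau> \<nu> \<le> spread \<nu>"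
    if \<nu>: "\<nu> \<in> circle_probs" and tail: "measure \<nu> {t \<in> sphere 0 1. \<bar>Arg t\<bar> \<ge> \<epsilon>} < \<epsilon>" for \<nu>
  proof
    define y where "y = centred_defect \<tau> \<nu>"
    define v where "v = (\<integral>t. sin (Arg t - centering_arg \<tau> \<nu>) \<partial>\<nu>)"
    have y: "0 \<le> y" "y \<le> 8 * \<epsilon>"
      using centred_defect_nonneg[OF \<nu>] centred_defect_small[OF \<nu> \<epsilon>(1) tail] by (simp_all add: y_def)
    show "spread \<nu> \<le> 1 / 2"
      using spread_le_centred_defect[OF \<nu>, of \<tau>] y \<epsilon> by (simp add: y_def)
    have "\<bar>v\<bar> \<le> L * y"
      unfolding v_def L_def y_def
      using abs_centering_arg_small[OF \<nu> \<epsilon>(1) tail, of \<tau>] \<epsilon>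
      by (intro centred_sine_bound[OF \<nu> \<tau>]) auto
    then have "v\<^sup>2 \<le> (L * y)\<^sup>2" using power_mono[of "\<bar>v\<bar>" "L * y" 2] by simp
    then have "y\<^sup>2 + v\<^sup>2 \<le> y * (y * (1 + L\<^sup>2))"
      by (simp add: power2_eq_square algebra_simps)
    also have "\<dots> \<le> y * 1"
    proof (rule mult_left_mono[OF _ y(1)])
      have "1 + L\<^sup>2 \<noteq> 0" using L by linarith
      then have "8 * \<delta> * (1 + L\<^sup>2) = 1" by (simp add: \<delta>_def field_simps)
      moreover have "y * (1 + L\<^sup>2) \<le> 8 * \<delta> * (1 + L\<^sup>2)"
        using y(2) \<epsilon>(5) L by (intro mult_right_mono) auto
      ultimately show "y * (1 + L\<^sup>2) \<le> 1" by linarith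
    qed
    finally have "y \<le> 1 - (1 - y)\<^sup>2 - v\<^sup>2" by (simp add: power2_diff)
    then show "centred_defect \<tau> \<nu> \<le> spread \<nu>"
      using spread_centred[OF \<nu>, of \<tau>] by (simp add: y_def v_def)
  qed
  then show ?thesis using \<epsilon>(1) by blast
qed

section \<open>Convergence to the Haar measure\<close>

lemma half_le_first_moment:
  assumes "\<nu> \<in> circle_probs" "spread \<nu> \<le> 1 / 2"
  shows "1 / 2 \<le> cmod (circle_moment \<nu> 1)"
proof (rule power2_le_imp_le)
  show "(1 / 2)\<^sup>2 \<le> (cmod (circle_moment \<nu> 1))\<^sup>2"
    using assms by (simp add: spread_def power2_eq_square)
qed simp

text \<open>The converse estimate to \<open>first_moment_le_exp_spread\<close>, from \<open>exp (- 2 s) \<le> 1 - s\<close> for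
  \<open>0 \<le> s \<le> 1 / 2\<close>.\<close>
lemma exp_spread_le_first_moment:
  assumes conv: "is_free_mult_conv_list T \<mu>s \<rho>" and small: "\<forall>\<mu>\<in>set \<mu>s. spread \<mu> \<le> 1 / 2"
  shows "exp (- total_spread \<mu>s) \<le> cmod (circle_moment \<rho> 1)"
proof -
  have "set \<mu>s \<subseteq> circle_probs" using free_mult_conv_list_circle_probs[OF conv] by blast
  then have *: "(exp (- total_spread \<mu>s))\<^sup>2 \<le> (cmod (prod_list (map (\<lambda>\<mu>. circle_moment \<mu> 1) \<mu>s)))\<^sup>2"
    using small
  proof (induction \<mu>s)
    case (Cons \<mu> \<mu>s)
    define x where "x = spread \<mu>"
    have x: "0 \<le> x" "x \<le> 1 / 2" using Cons.prems spread_nonneg by (auto simp: x_def)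
    have "x * (2 * x) \<le> x * 1" using x by (intro mult_left_mono) auto
    then have "1 \<le> (1 - x) * (1 + 2 * x)" by (simp add: algebra_simps)
    also have "\<dots> \<le> (1 - x) * exp (2 * x)"
      using x exp_ge_add_one_self[of "2 * x"] by (intro mult_left_mono) auto
    finally have "exp (- x) ^ 2 \<le> 1 - x"
      by (simp add: exp_minus field_simps flip: exp_double)
    then have "exp (- x) ^ 2 \<le> (cmod (circle_moment \<mu> 1))\<^sup>2" by (simp add: x_def spread_def)
    then have "exp (- x) ^ 2 * exp (- total_spread \<mu>s) ^ 2 \<le> (cmod (circle_moment \<mu> 1))\<^sup>2 *
        (cmod (prod_list (map (\<lambda>\<mu>. circle_moment \<mu> 1) \<mu>s)))\<^sup>2"
      using Cons by (intro mult_mono) auto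
    moreover have "exp (- total_spread (\<mu> # \<mu>s)) = exp (- x) * exp (- total_spread \<mu>s)"
      by (simp add: total_spread_def x_def flip: exp_add)
    ultimately show ?case by (simp add: norm_mult power_mult_distrib)
  qed (simp add: total_spread_def)
  then show ?thesis
    unfolding free_mult_conv_list_first_moment[OF conv] by (rule power2_le_imp_le) simp
qed

lemma spread_circle_dirac:
  assumes "cmod c = 1"
  shows "spread (circle_dirac c) = 0"
proof -
  have "circle_moment (circle_dirac c) 1 = c"
    unfolding circle_moment_def circle_dirac_def
    by (subst integral_return) (use assms in \<open>auto simp: circle_borel_def space_restrict_space
      intro!: measurable_restrict_space1\<close>)
  then show ?thesis using assms by (simp add: spread_def)
qed

theorem theorem4p4:
  fixes k :: "nat \<Rightarrow> nat"
    and \<nu> :: "nat \<Rightarrow> nat \<Rightarrow> complex measure"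
    and \<tau> :: real
    and lam :: "nat \<Rightarrow> complex"
    and \<rho> :: "nat \<Rightarrow> complex measure"
  assumes "\<And>n. n \<ge> 1 \<Longrightarrow> k n \<ge> 1"
    and "\<And>n j. n \<ge> 1 \<Longrightarrow> 1 \<le> j \<Longrightarrow> j \<le> k n \<Longrightarrow> \<nu> n j \<in> circle_probs_nz"
    and "infinitesimal_array k \<nu>"
    and "0 < \<tau>" and "\<tau> < pi"
    and "\<And>n. n \<ge> 1 \<Longrightarrow> lam n \<in> sphere 0 1"
    and "\<And>n. n \<ge> 1 \<Longrightarrow>
      is_free_mult_conv_list TYPE('a::ring_1)
        (map (\<nu> n) [1..<Suc (k n)] @ [circle_dirac (lam n)]) (\<rho> n)"
  shows "circle_weak_conv \<rho> circle_haar \<longleftrightarrow>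
    filterlim (\<lambda>n. \<Sum>j=1..k n. \<integral>t. (1 - Re t) \<partial>(centered \<tau> (\<nu> n j))) at_top sequentially"
proof -
  \<comment> \<open>The point mass has spread \<open>0\<close>, so it can be treated as one more factor.\<close>
  define \<mu>s where "\<mu>s n = map (\<nu> n) [1..<Suc (k n)] @ [circle_dirac (lam n)]" for n
  define S where "S n = total_spread (\<mu>s n)" for n
  define Y where "Y n = (\<Sum>j=1..k n. centred_defect \<tau> (\<nu> n j))" for n
  have \<nu>: "\<nu> n j \<in> circle_probs" if "n \<ge> 1" "j \<in> {1..k n}" for n j
    using assms(2)[of n j] that by (auto simp: circle_probs_nz_def)
  have conv: "is_free_mult_conv_list TYPE('a) (\<mu>s n) (\<rho> n)" if "n \<ge> 1" for n
    using assms(7)[OF that] by (simp only: \<mu>s_def)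
  have \<rho>: "\<rho> n \<in> circle_probs" if "n \<ge> 1" for n
    using free_mult_conv_list_circle_probs[OF conv[OF that]] by blast
  have S_eq: "S n = (\<Sum>j=1..k n. spread (\<nu> n j))" if "n \<ge> 1" for n
  proof -
    have "S n = sum_list (map (\<lambda>j. spread (\<nu> n j)) [1..<Suc (k n)])"
      using assms(6)[OF that] by (simp add: S_def total_spread_def \<mu>s_def spread_circle_dirac o_def del: upt_Suc)
    also have "\<dots> = (\<Sum>j=1..k n. spread (\<nu> n j))"
      by (simp only: interv_sum_list_conv_sum_set_nat set_upt atLeastLessThanSuc_atLeastAtMost)
    finally show ?thesis .
  qed
  obtain \<epsilon> where \<epsilon>: "0 < \<epsilon>" and cmp: "\<And>\<mu>. \<mu> \<in> circle_probs \<Longrightarrow>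
      measure \<mu> {t \<in> sphere 0 1. \<bar>Arg t\<bar> \<ge> \<epsilon>} < \<epsilon> \<Longrightarrow>
      spread \<mu> \<le> 1 / 2 \<and> centred_defect \<tau> \<mu> \<le> spread \<mu>"
    using centred_defect_le_spread[OF assms(4,5)] by blast
  have "(\<lambda>n. MAX j\<in>{1..k n}. measure (\<nu> n j) {t \<in> sphere 0 1. \<bar>Arg t\<bar> \<ge> \<epsilon>}) \<longlonglongrightarrow> 0"
    using assms(3) \<epsilon> by (simp add: infinitesimal_array_def)
  then have "\<forall>\<^sub>F n in sequentially.
      (MAX j\<in>{1..k n}. measure (\<nu> n j) {t \<in> sphere 0 1. \<bar>Arg t\<bar> \<ge> \<epsilon>}) < \<epsilon>"
    using \<epsilon> by (rule order_tendstoD)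
  then have good: "\<forall>\<^sub>F n in sequentially. n \<ge> 1 \<and>
      (\<forall>j\<in>{1..k n}. spread (\<nu> n j) \<le> 1 / 2 \<and> centred_defect \<tau> (\<nu> n j) \<le> spread (\<nu> n j))"
    using eventually_ge_at_top[of 1]
  proof eventually_elim
    case (elim n)
    have "measure (\<nu> n j) {t \<in> sphere 0 1. \<bar>Arg t\<bar> \<ge> \<epsilon>} < \<epsilon>" if "j \<in> {1..k n}" for j
      using elim(1) that by (auto intro: le_less_trans[OF Max_ge])
    then show ?case using cmp \<nu> elim(2) by blast
  qed
  then have small: "\<forall>\<^sub>F n in sequentially. n \<ge> 1 \<and> (\<forall>\<mu>\<in>set (\<mu>s n). \<mu> \<in> circle_probs \<and> spread \<mu> \<le> 1 / 2)"
  proof eventually_elim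
    case (elim n)
    then have "set (\<mu>s n) \<subseteq> circle_probs"
      using free_mult_conv_list_circle_probs[OF conv] by blast
    moreover have "spread (circle_dirac (lam n)) = 0"
      using elim assms(6) by (intro spread_circle_dirac) auto
    ultimately show ?case using elim by (auto simp: \<mu>s_def simp del: upt_Suc)
  qed

  have spread_iff: "filterlim S at_top sequentially \<longleftrightarrow> filterlim Y at_top sequentially"
  proof
    assume "filterlim S at_top sequentially"
    moreover have "\<forall>\<^sub>F n in sequentially. S n \<le> 2 * Y n"
      using eventually_ge_at_top[of 1]
    proof eventually_elim
      case (elim n)
      show ?case
        unfolding S_eq[OF elim] Y_def sum_distrib_left
        using \<nu> elim by (intro sum_mono spread_le_centred_defect) auto
    qed
    ultimately have "filterlim (\<lambda>n. 2 * Y n) at_top sequentially"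
      by (rule filterlim_at_top_mono)
    then have "filterlim (\<lambda>n. 1 / 2 * (2 * Y n)) at_top sequentially"
      by (rule filterlim_tendsto_pos_mult_at_top[OF tendsto_const, rotated]) simp
    then show "filterlim Y at_top sequentially" by simp
  next
    assume "filterlim Y at_top sequentially"
    moreover have "\<forall>\<^sub>F n in sequentially. Y n \<le> S n"
      using good by eventually_elim (auto simp: S_eq Y_def intro!: sum_mono)
    ultimately show "filterlim S at_top sequentially"
      by (rule filterlim_at_top_mono)
  qed

  have "circle_weak_conv \<rho> circle_haar \<longleftrightarrow> filterlim S at_top sequentially"
  proof
    assume weak: "circle_weak_conv \<rho> circle_haar"
    have haar_int: "integrable circle_haar (\<lambda>t. t)"
      by (intro integrable_circle_continuous circle_haar_circle_probs continuous_intros)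
    have haar_1: "(\<integral>t. t \<partial>circle_haar) = 0"
      using circle_haar_moment[of 1] by (simp add: circle_moment_def)
    have Re: "(\<lambda>n. \<integral>t. Re t \<partial>\<rho> n) \<longlonglongrightarrow> 0"
      using weak[unfolded circle_weak_conv_def, rule_format, of Re] haar_1
      by (simp add: integral_Re[OF haar_int] continuous_intros)
    have Im: "(\<lambda>n. \<integral>t. Im t \<partial>\<rho> n) \<longlonglongrightarrow> 0"
      using weak[unfolded circle_weak_conv_def, rule_format, of Im] haar_1
      by (simp add: integral_Im[OF haar_int] continuous_intros)
    have "(\<lambda>n. Complex (\<integral>t. Re t \<partial>\<rho> n) (\<integral>t. Im t \<partial>\<rho> n)) \<longlonglongrightarrow> Complex 0 0"
      by (intro tendsto_Complex Re Im)
    moreover have "\<forall>\<^sub>F n in sequentially.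
        Complex (\<integral>t. Re t \<partial>\<rho> n) (\<integral>t. Im t \<partial>\<rho> n) = circle_moment (\<rho> n) 1"
      using eventually_ge_at_top[of 1]
    proof eventually_elim
      case (elim n)
      have "integrable (\<rho> n) (\<lambda>t. t)"
        by (intro integrable_circle_continuous \<rho> elim continuous_intros)
      then show ?case by (simp add: circle_moment_def complex_eq_iff)
    qed
    ultimately have "(\<lambda>n. circle_moment (\<rho> n) 1) \<longlonglongrightarrow> Complex 0 0"
      by (rule Lim_transform_eventually)
    moreover have "Complex 0 0 = 0" by (simp add: complex_eq_iff)
    ultimately have "(\<lambda>n. circle_moment (\<rho> n) 1) \<longlonglongrightarrow> 0" by (simp only:)
    then have lim: "(\<lambda>n. cmod (circle_moment (\<rho> n) 1)) \<longlonglongrightarrow> 0"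
      by (rule tendsto_norm_zero)
    show "filterlim S at_top sequentially"
      unfolding filterlim_at_top
    proof
      fix Z :: real
      have "\<forall>\<^sub>F n in sequentially. cmod (circle_moment (\<rho> n) 1) < exp (- Z)"
        using lim by (rule order_tendstoD) simp
      with small show "\<forall>\<^sub>F n in sequentially. Z \<le> S n"
      proof eventually_elim
        case (elim n)
        then have "exp (- S n) \<le> cmod (circle_moment (\<rho> n) 1)"
          unfolding S_def using exp_spread_le_first_moment[OF conv[of n]] by blast
        then have "exp (- S n) < exp (- Z)" using elim by linarith
        then show ?case by simp
      qed
    qed
  next
    assume S: "filterlim S at_top sequentially"
    have moments: "(\<lambda>n. circle_moment (\<rho> n) q) \<longlonglongrightarrow> 0" if q: "0 < q" for q
    proof -
      obtain A N where A: "A \<ge> 1" and bound: "\<And>\<mu>s \<rho>. is_free_mult_conv_list TYPE('a) \<mu>s \<rho> \<Longrightarrow>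
          \<forall>\<mu>\<in>set \<mu>s. 1 / 2 \<le> cmod (circle_moment \<mu> 1) \<Longrightarrow>
          cmod (circle_moment \<rho> q) \<le> A * (1 + total_spread \<mu>s) ^ N * cmod (circle_moment \<rho> 1) ^ q"
        using free_mult_conv_list_moment_bound[of "Suc q" "TYPE('a)"] by blast
      have "((\<lambda>s::real. A * (1 + s) ^ N * exp (- s / 2)) \<longlongrightarrow> 0) at_top"
        by real_asymp
      then have lim: "(\<lambda>n. A * (1 + S n) ^ N * exp (- S n / 2)) \<longlonglongrightarrow> 0"
        using S by (rule filterlim_compose)
      have "\<forall>\<^sub>F n in sequentially.
          norm (circle_moment (\<rho> n) q) \<le> A * (1 + S n) ^ N * exp (- S n / 2)"
        using small
      proof eventually_elim
        case (elim n)
        let ?m = "cmod (circle_moment (\<rho> n) 1)"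
        have S0: "0 \<le> S n" unfolding S_def using elim by (intro total_spread_nonneg) auto
        have "cmod (circle_moment (\<rho> n) q) \<le> A * (1 + S n) ^ N * ?m ^ q"
          unfolding S_def using elim by (intro bound conv ballI half_le_first_moment) auto
        also have "\<dots> \<le> A * (1 + S n) ^ N * exp (- S n / 2)"
        proof (rule mult_left_mono)
          have "?m ^ q \<le> ?m ^ 1"
            using q elim cmod_circle_moment_le[OF \<rho>, of n 1] by (intro power_decreasing) auto
          also have "\<dots> \<le> exp (- S n / 2)"
            unfolding S_def using elim first_moment_le_exp_spread[OF conv] by simp
          finally show "?m ^ q \<le> exp (- S n / 2)" .
        qed (use A S0 in auto)
        finally show ?case .
      qed
      then show ?thesis using lim by (rule Lim_null_comparison)
    qed
    \<comment> \<open>Nothing is known about \<open>\<rho> 0\<close>, hence the shift of the sequence.\<close>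
    have "circle_weak_conv (\<lambda>n. \<rho> (Suc n)) circle_haar"
    proof (rule weak_conv_if_moments_tendsto)
      fix q
      show "(\<lambda>n. circle_moment (\<rho> (Suc n)) q) \<longlonglongrightarrow> circle_moment circle_haar q"
      proof (cases "q = 0")
        case True
        then show ?thesis
          using \<rho> circle_haar_circle_probs by (simp add: circle_moment_0)
      next
        case False
        then show ?thesis using LIMSEQ_Suc[OF moments[of q]] by (simp add: circle_haar_moment)
      qed
    qed (use \<rho> circle_haar_circle_probs in auto)
    then show "circle_weak_conv \<rho> circle_haar"
      unfolding circle_weak_conv_def by (intro allI impI) (rule LIMSEQ_imp_Suc, simp)
  qed
  then show ?thesis
    unfolding spread_iff by (simp add: Y_def[abs_def] centred_defect_def)
qed

end
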